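(* Let $\mathbb{F}$ be a field and let $L$ be a nilpotent symplectic alternating algebra over $\mathbb{F}$ of dimension $10$ with an isotropic center $Z(L)$ of dimension $4$ such that $L^{3}=Z(L)$ and $L$ is of type C. Then $L$ has a presentation of the form $$\mathcal{P}_{10}^{(4,4)}(\alpha,\beta):\ (x_{1}y_{2},y_{3})=1,\ (x_{1}y_{3},y_{4})=\alpha,\ (x_{1}y_{4},y_{5})=\beta,\ (y_{1}y_{2},y_{5})=1,\ (y_{1}y_{3},y_{4})=1,$$ where $\alpha,\beta\in\mathbb{F}$ and the polynomial $t^{2}+\alpha t+\beta$ is irreducible in $\mathbb{F}[t]$. Conversely, any such presentation (with $t^{2}+\alpha t+\beta$ irreducible) gives an algebra of type C (i.e. a nilpotent SAA of dimension $10$ with isotropic center of dimension $4$, with $L^3=Z(L)$, of type C). Furthermore, two such presentations $\mathcal{P}_{10}^{(4,4)}(\alpha,\beta)$ and $\mathcal{P}_{10}^{(4,4)}(\tilde\alpha,\tilde\beta)$ describe the same algebra (up to isomorphism) if and only if $$\tilde{\alpha}=\frac{(ad+bc)\alpha+2ac\beta+2bd}{d^{2}+\alpha cd+c^{2}\beta},\qquad \tilde{\beta}=\frac{b^{2}+ab\alpha+a^{2}\beta}{d^{2}+cd\alpha+c^{2}\beta}$$ for some $a,b,c,d\in\mathbb{F}$ with $ad-bc=1$.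
   Context: A symplectic alternating algebra (SAA) over a field $\mathbb{F}$ is a finite-dimensional $\mathbb{F}$-vector space $L$ with a non-degenerate alternating bilinear form $(\cdot,\cdot)$ and a bilinear alternating product $L\times L\to L$, $(x,y)\mapsto xy$ (so $xx=0$), such that $(xy,z)=(yz,x)$ for all $x,y,z\in L$. Consequently $(u,v,w)\mapsto (uv,w)$ is an alternating trilinear form, and by non-degeneracy it determines the product. An isomorphism of SAAs is a linear bijection preserving both the product and the form. For subspaces $U,V\le L$, $UV$ denotes the linear span of all products $uv$ with $u\in U$, $v\in V$. Put $L^{1}=L$, $L^{k+1}=L^{k}L$; $L$ is nilpotent if $L^{k+1}=0$ for some $k$. The center is $Z(L)=\{z\in L: zx=0 \text{ for all } x\in L\}$. A subspace $U$ is isotropic if $(u,v)=0$ for all $u,v\in U$. A standard basis of a $10$-dimensional $L$ is a basis $x_{1},y_{1},\ldots,x_{5},y_{5}$ with $(x_i,x_j)=(y_i,y_j)=0$ and $(x_i,y_j)=\delta_{ij}$. A nilpotent presentation lists values of the triples $(x_iy_j,y_k)$ and $(y_iy_j,y_k)$ with $1\le i<j<k\le 5$ with respect to a standard basis. By convention, all triple values $(uv,w)$ of basis vectors $u,v,w$ which do not follow from the listed ones by the alternating property are $0$. Such a presentation determines an SAA up to isomorphism. Let $L$ be a nilpotent SAA of dimension $10$ with isotropic center of dimension $4$ and $L^{3}=Z(L)$. Then $L^{2}/Z(L)$ is $2$-dimensional, $L/L^{2}$ is $4$-dimensional and $L^2$ is abelian. For $\bar z=z+Z(L)\in L^{2}/Z(L)$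 one has the well-defined alternating form $\phi_{\bar z}:L/L^{2}\times L/L^{2}\to\mathbb{F}$, $\phi_{\bar z}(u+L^{2},v+L^{2})=(zu,v)$. $L$ is of type C if $\phi_{\bar z}$ is non-degenerate for all $0\neq\bar z\in L^{2}/Z(L)$. *)

theory Defs
  imports
    "HOL-Analysis.Analysis"
    "HOL-Computational_Algebra.Polynomial"
begin

text \<open>
  The algebra is the whole type \<open>'v\<close>, with scalar multiplication \<open>scale\<close> over the
  field \<open>'f\<close>; \<open>form x y\<close> is the symplectic form $(x,y)$ and \<open>mult x y\<close> the product $xy$.
\<close>

locale saa = vector_space scale
  for scale :: "'f::field \<Rightarrow> 'v::ab_group_add \<Rightarrow> 'v" +
  fixes form :: "'v \<Rightarrow> 'v \<Rightarrow> 'f"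
    and mult :: "'v \<Rightarrow> 'v \<Rightarrow> 'v"
  assumes finite_dim: "\<exists>B. finite B \<and> span B = UNIV"
    and form_linear_left: "\<And>y. Vector_Spaces.linear scale (*) (\<lambda>x. form x y)"
    and form_linear_right: "\<And>x. Vector_Spaces.linear scale (*) (\<lambda>y. form x y)"
    and form_alternating: "\<And>x. form x x = 0"
    and form_nondegenerate: "\<And>x. (\<forall>y. form x y = 0) \<Longrightarrow> x = 0"
    and mult_linear_left: "\<And>y. Vector_Spaces.linear scale scale (\<lambda>x. mult x y)"
    and mult_linear_right: "\<And>x. Vector_Spaces.linear scale scale (\<lambda>y. mult x y)"
    and mult_alternating: "\<And>x. mult x x = 0"
    and form_mult_cyclic: "\<And>x y z. form (mult x y) z = form (mult y z) x"

datatype basis_index = X nat | Y nat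

text \<open>
  A presentation is a set of listed values \<open>((p, q, r), c)\<close>, meaning $(e_p e_q, e_r) = c$
  for the basis vectors $e_p, e_q, e_r$.
\<close>

type_synonym 'f presentation = "((basis_index \<times> basis_index \<times> basis_index) \<times> 'f) set"

context saa
begin

definition set_product :: "'v set \<Rightarrow> 'v set \<Rightarrow> 'v set" where
  "set_product U V = span {mult u v | u v. u \<in> U \<and> v \<in> V}"

text \<open>\<open>lower_power k\<close> is $L^k$ for $k \ge 1$; the value at $0$ is irrelevant.\<close>

definition lower_power :: "nat \<Rightarrow> 'v set" where
  "lower_power k = ((\<lambda>U. set_product U UNIV) ^^ (k - 1)) UNIV"

definition nilpotent :: bool where
  "nilpotent \<longleftrightarrow> (\<exists>k. lower_power (k + 1) = {0})"

definition center :: "'v set" where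
  "center = {z. \<forall>x. mult z x = 0}"

definition isotropic :: "'v set \<Rightarrow> bool" where
  "isotropic U \<longleftrightarrow> (\<forall>u\<in>U. \<forall>v\<in>U. form u v = 0)"

text \<open>
  The form $\phi_{\bar z}$ on $L/L^2$, with $z \in L^2$ taken modulo $Z(L)$, written on
  representatives. The lemma \<open>phi_cong\<close> below shows that it depends on the cosets only.
\<close>

definition phi :: "'v \<Rightarrow> 'v \<Rightarrow> 'v \<Rightarrow> 'f" where
  "phi z u v = form (mult z u) v"

text \<open>
  Non-degeneracy on the quotient: a coset $u + L^2$ in the radical of $\phi_{\bar z}$ is zero,
  that is, $u \in L^2$.
\<close>

definition type_C :: bool where
  "type_C \<longleftrightarrow> (\<forall>z \<in> lower_power 2 - center.
     \<forall>u. (\<forall>v. phi z u v = 0) \<longrightarrow> u \<in> lower_power 2)"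

definition standard_basis :: "(nat \<Rightarrow> 'v) \<Rightarrow> (nat \<Rightarrow> 'v) \<Rightarrow> bool" where
  "standard_basis x y \<longleftrightarrow>
     card (x ` {1..5} \<union> y ` {1..5}) = 10 \<and>
     independent (x ` {1..5} \<union> y ` {1..5}) \<and>
     span (x ` {1..5} \<union> y ` {1..5}) = UNIV \<and>
     (\<forall>i\<in>{1..5}. \<forall>j\<in>{1..5}.
        form (x i) (x j) = 0 \<and> form (y i) (y j) = 0 \<and>
        form (x i) (y j) = (if i = j then 1 else 0))"

text \<open>
  The triple values that follow from a listed $(uv,w)$ with $u,v,w$ distinct by the alternating
  property are those at the permutations of $u,v,w$, i.e. at the triples with the same underlying
  set. All triple values at other index triples are required to be $0$.
\<close>

definition has_presentation :: "'f presentation \<Rightarrow> bool" where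
  "has_presentation P \<longleftrightarrow> (\<exists>x y. standard_basis x y \<and>
     (let e = case_basis_index x y; I = X ` {1..5} \<union> Y ` {1..5} in
       (\<forall>((p, q, r), c) \<in> P. form (mult (e p) (e q)) (e r) = c) \<and>
       (\<forall>p\<in>I. \<forall>q\<in>I. \<forall>r\<in>I.
          (\<forall>((p', q', r'), c) \<in> P. {p, q, r} \<noteq> {p', q', r'}) \<longrightarrow>
          form (mult (e p) (e q)) (e r) = 0)))"

end

locale saa_type_C = saa scale form mult
  for scale :: "'f::field \<Rightarrow> 'v::ab_group_add \<Rightarrow> 'v" and form mult +
  assumes nilpotent: "nilpotent"
    and dim_10: "dim UNIV = 10"
    and isotropic_center: "isotropic center"
    and dim_center: "dim center = 4"
    and lower_power_3: "lower_power 3 = center"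
    and type_C: "type_C"

definition P10_44 :: "'f::field \<Rightarrow> 'f \<Rightarrow> 'f presentation" where
  "P10_44 \<alpha> \<beta> =
    {((X 1, Y 2, Y 3), 1), ((X 1, Y 3, Y 4), \<alpha>), ((X 1, Y 4, Y 5), \<beta>),
     ((Y 1, Y 2, Y 5), 1), ((Y 1, Y 3, Y 4), 1)}"

definition saa_isomorphic ::
  "('f::field \<Rightarrow> 'v::ab_group_add \<Rightarrow> 'v) \<Rightarrow> ('v \<Rightarrow> 'v \<Rightarrow> 'f) \<Rightarrow> ('v \<Rightarrow> 'v \<Rightarrow> 'v) \<Rightarrow>
   ('f \<Rightarrow> 'w::ab_group_add \<Rightarrow> 'w) \<Rightarrow> ('w \<Rightarrow> 'w \<Rightarrow> 'f) \<Rightarrow> ('w \<Rightarrow> 'w \<Rightarrow> 'w) \<Rightarrow> bool" where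
  "saa_isomorphic s \<omega> m s' \<omega>' m' \<longleftrightarrow>
     (\<exists>f. Vector_Spaces.linear s s' f \<and> bij f \<and>
          (\<forall>x y. f (m x y) = m' (f x) (f y)) \<and>
          (\<forall>x y. \<omega>' (f x) (f y) = \<omega> x y))"

context saa
begin

lemma mult_zero_if_center: "z \<in> center \<Longrightarrow> mult z u = 0"
  by (simp add: center_def)

lemma form_zero [simp]: "form 0 v = 0" "form v 0 = 0"
  using module_hom.zero[OF Vector_Spaces.linear.axioms(3)[OF form_linear_left]]
    module_hom.zero[OF Vector_Spaces.linear.axioms(3)[OF form_linear_right]] by auto

lemma lower_power_2_eq: "lower_power 2 = set_product UNIV UNIV"
  by (simp add: lower_power_def)

lemma lower_power_3_eq: "lower_power 3 = set_product (lower_power 2) UNIV"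
  by (simp add: lower_power_def numeral_3_eq_3 numeral_2_eq_2)

lemma form_center_lower_power_2:
  assumes "w \<in> lower_power 2" "z \<in> center"
  shows "form w z = 0"
proof -
  interpret h: module_hom scale "(*)" "\<lambda>x. form x z"
    using Vector_Spaces.linear.axioms(3)[OF form_linear_left] .
  have "w \<in> span {mult u v | u v. u \<in> UNIV \<and> v \<in> UNIV}"
    using assms(1) by (simp add: lower_power_2_eq set_product_def)
  then show ?thesis
  proof (induction rule: span_induct)
    case base
    show ?case
      by (auto simp: subspace_def h.add h.scale h.zero)
  next
    case (step w)
    then obtain u v where "w = mult u v" by auto
    then show ?case
      using assms(2) form_mult_cyclic[of u v z] form_mult_cyclic[of v z u]
      by (simp add: mult_zero_if_center)
  qed
qed

lemma form_antisym: "form x y = - form y x"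
proof -
  have l: "form (a + b) c = form a c + form b c" for a b c
    using module_hom.add[OF Vector_Spaces.linear.axioms(3)[OF form_linear_left]] .
  have r: "form a (b + c) = form a b + form a c" for a b c
    using module_hom.add[OF Vector_Spaces.linear.axioms(3)[OF form_linear_right]] .
  have "form (x + y) (x + y) = form x x + form x y + (form y x + form y y)"
    by (simp only: l r add_ac)
  then show ?thesis
    by (simp only: form_alternating eq_neg_iff_add_eq_0 add_0_left add_0_right)
qed

lemma mult_lower_power_2_zero:
  assumes "lower_power 3 = center" "z \<in> lower_power 2" "u \<in> lower_power 2"
  shows "mult z u = 0"
proof (rule form_nondegenerate, rule allI)
  fix v
  have "mult u v \<in> center"
    unfolding assms(1)[symmetric] lower_power_3_eq set_product_def
    using assms(3) by (intro span_base) auto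
  moreover have "form (mult u v) z = - form z (mult u v)"
    by (rule form_antisym)
  ultimately show "form (mult z u) v = 0"
    using form_center_lower_power_2[OF assms(2)] form_mult_cyclic[of z u v]
    by simp
qed

lemma phi_cong:
  assumes "lower_power 3 = center"
    and "z \<in> lower_power 2" "z - z' \<in> center"
    and "u - u' \<in> lower_power 2" "v - v' \<in> lower_power 2"
  shows "phi z u v = phi z' u' v'"
proof -
  have l: "mult (a - b) c = mult a c - mult b c" for a b c
    using module_hom.diff[OF Vector_Spaces.linear.axioms(3)[OF mult_linear_left]] .
  have r: "mult a (b - c) = mult a b - mult a c" for a b c
    using module_hom.diff[OF Vector_Spaces.linear.axioms(3)[OF mult_linear_right]] .
  have fr: "form a (b - c) = form a b - form a c" for a b c
    using module_hom.diff[OF Vector_Spaces.linear.axioms(3)[OF form_linear_right]] .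
  have "mult z u = mult z u'"
    using mult_lower_power_2_zero[OF assms(1,2,4)] by (simp add: r)
  moreover have "mult z u' = mult z' u'"
    using mult_zero_if_center[OF assms(3), of u'] by (simp add: l)
  moreover have "form (mult z u') (v - v') = 0"
    using mult_lower_power_2_zero[OF assms(1,5,2)]
      form_mult_cyclic[of "v - v'" z u'] by simp
  ultimately show ?thesis
    by (simp add: phi_def fr)
qed

end

end

theory Submission
  imports Defs
begin

text \<open>
  Choose a symplectic pair \<open>a, b\<close> in \<open>L\<^sup>2\<close> modulo the center. Both forms \<open>\<phi>\<^sub>a, \<phi>\<^sub>b\<close> on the four-dimensional
  space \<open>L/L\<^sup>2\<close> are non-degenerate, so \<open>A = \<phi>\<^sub>b\<^sup>-\<^sup>1 \<phi>\<^sub>a\<close> is an operator on \<open>L/L\<^sup>2\<close>; it satisfies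
  \<open>A\<^sup>2 = \<alpha> A - \<beta>\<close>, and the plane spanned by any nonzero \<open>v\<close> and \<open>A v\<close> is isotropic for both forms. A
  complementary plane of the same kind yields the listed values of \<open>\<phi>\<^sub>a\<close> and \<open>\<phi>\<^sub>b\<close>. The remaining
  triple values on \<open>L/L\<^sup>2\<close> are killed by adding multiples of \<open>a\<close> and \<open>b\<close> to the representatives,
  and the symplectic form is normalized by adding central elements, which changes no product. The
  Pfaffian of \<open>s \<phi>\<^sub>a + t \<phi>\<^sub>b\<close> is \<open>t\<^sup>2 + \<alpha> s t + \<beta> s\<^sup>2\<close>, so type C amounts to irreducibility.

  The parameters depend only on the pair \<open>a, b\<close> modulo the center. Another pair arises from a matrix
  of determinant \<open>1\<close>, which replaces \<open>A\<close> by \<open>(c A + d)\<^sup>-\<^sup>1 (a A + b)\<close>; the stated formulas are the trace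
  and the norm of this element of the quadratic extension generated by \<open>A\<close>.
\<close>

section \<open>Irreducible quadratic polynomials\<close>

text \<open>A factorization into nonunits has a factor of degree 1, and the root of that factor is a
  root of the quadratic.\<close>

lemma irreducible_monic_quadratic_iff:
  fixes \<alpha> \<beta> :: "'a::field"
  shows "irreducible [:\<beta>, \<alpha>, 1:] \<longleftrightarrow> (\<forall>r. r\<^sup>2 + \<alpha> * r + \<beta> \<noteq> 0)"
proof
  assume irr: "irreducible [:\<beta>, \<alpha>, 1:]"
  show "\<forall>r. r\<^sup>2 + \<alpha> * r + \<beta> \<noteq> 0"
  proof (intro allI notI)
    fix r assume "r\<^sup>2 + \<alpha> * r + \<beta> = 0"
    then have "\<beta> = - r * (r + \<alpha>)"
      by (simp add: power2_eq_square algebra_simps eq_neg_iff_add_eq_0)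
    then have "[:\<beta>, \<alpha>, 1:] = [:- r, 1:] * [:r + \<alpha>, 1:]"
      by simp
    then have "[:- r, 1:] dvd 1 \<or> [:r + \<alpha>, 1:] dvd 1"
      using irr irreducibleD by blast
    then show False
      by (simp add: is_unit_iff_degree)
  qed
next
  assume noroot: "\<forall>r. r\<^sup>2 + \<alpha> * r + \<beta> \<noteq> 0"
  show "irreducible [:\<beta>, \<alpha>, 1:]"
  proof (rule irreducibleI)
    show "[:\<beta>, \<alpha>, 1:] \<noteq> 0" by simp
    show "\<not> [:\<beta>, \<alpha>, 1:] dvd 1" by (simp add: is_unit_iff_degree)
  next
    fix p q assume pq: "[:\<beta>, \<alpha>, 1:] = p * q"
    have nz: "p \<noteq> 0" "q \<noteq> 0" using pq by auto
    have "degree p + degree q = 2"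
      using degree_mult_eq[OF nz] pq[symmetric] by simp
    moreover have "degree p \<noteq> 1"
    proof
      assume "degree p = 1"
      then obtain a b where ab: "p = [:a, b:]" "b \<noteq> 0"
        by (cases p, auto split: if_splits elim: degree_eq_zeroE)
      have "poly [:\<beta>, \<alpha>, 1:] (- a / b) = 0"
        unfolding pq using ab by simp
      then have "(- a / b)\<^sup>2 + \<alpha> * (- a / b) + \<beta> = 0"
        by (simp add: power2_eq_square algebra_simps)
      then show False using noroot by blast
    qed
    ultimately have "degree p = 0 \<or> degree q = 0" by linarith
    then show "p dvd 1 \<or> q dvd 1"
      using nz by (simp add: is_unit_iff_degree)
  qed
qed

section \<open>Symplectic alternating algebras\<close>

context saa
begin

lemma form_add_left: "form (a + b) c = form a c + form b c"
  using module_hom.add[OF Vector_Spaces.linear.axioms(3)[OF form_linear_left]] .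

lemma form_add_right: "form a (b + c) = form a b + form a c"
  using module_hom.add[OF Vector_Spaces.linear.axioms(3)[OF form_linear_right]] .

lemma form_scale_left: "form (scale r a) b = r * form a b"
  using module_hom.scale[OF Vector_Spaces.linear.axioms(3)[OF form_linear_left]] .

lemma form_scale_right: "form a (scale r b) = r * form a b"
  using module_hom.scale[OF Vector_Spaces.linear.axioms(3)[OF form_linear_right]] .

lemma form_minus_left: "form (- a) b = - form a b"
  using module_hom.neg[OF Vector_Spaces.linear.axioms(3)[OF form_linear_left]] .

lemma form_minus_right: "form a (- b) = - form a b"
  using module_hom.neg[OF Vector_Spaces.linear.axioms(3)[OF form_linear_right]] .

lemma form_diff_left: "form (a - b) c = form a c - form b c"
  using module_hom.diff[OF Vector_Spaces.linear.axioms(3)[OF form_linear_left]] .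

lemma form_diff_right: "form a (b - c) = form a b - form a c"
  using module_hom.diff[OF Vector_Spaces.linear.axioms(3)[OF form_linear_right]] .

lemma form_sum_left: "form (sum f A) b = (\<Sum>i\<in>A. form (f i) b)"
  using module_hom.sum[OF Vector_Spaces.linear.axioms(3)[OF form_linear_left]] .

lemma mult_add_left: "mult (a + b) c = mult a c + mult b c"
  using module_hom.add[OF Vector_Spaces.linear.axioms(3)[OF mult_linear_left]] .

lemma mult_add_right: "mult a (b + c) = mult a b + mult a c"
  using module_hom.add[OF Vector_Spaces.linear.axioms(3)[OF mult_linear_right]] .

lemma mult_scale_left: "mult (scale r a) b = scale r (mult a b)"
  using module_hom.scale[OF Vector_Spaces.linear.axioms(3)[OF mult_linear_left]] .

lemma mult_scale_right: "mult a (scale r b) = scale r (mult a b)"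
  using module_hom.scale[OF Vector_Spaces.linear.axioms(3)[OF mult_linear_right]] .

lemma mult_minus_left: "mult (- a) b = - mult a b"
  using module_hom.neg[OF Vector_Spaces.linear.axioms(3)[OF mult_linear_left]] .

lemma mult_minus_right: "mult a (- b) = - mult a b"
  using module_hom.neg[OF Vector_Spaces.linear.axioms(3)[OF mult_linear_right]] .

lemma mult_diff_left: "mult (a - b) c = mult a c - mult b c"
  using module_hom.diff[OF Vector_Spaces.linear.axioms(3)[OF mult_linear_left]] .

lemma mult_diff_right: "mult a (b - c) = mult a b - mult a c"
  using module_hom.diff[OF Vector_Spaces.linear.axioms(3)[OF mult_linear_right]] .

lemma mult_zero_left [simp]: "mult 0 b = 0"
  using module_hom.zero[OF Vector_Spaces.linear.axioms(3)[OF mult_linear_left]] .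

lemma mult_zero_right [simp]: "mult a 0 = 0"
  using module_hom.zero[OF Vector_Spaces.linear.axioms(3)[OF mult_linear_right]] .

lemmas form_bilinear =
  form_add_left form_add_right form_scale_left form_scale_right form_minus_left
  form_minus_right form_diff_left form_diff_right

lemmas mult_bilinear =
  mult_add_left mult_add_right mult_scale_left mult_scale_right mult_minus_left
  mult_minus_right mult_diff_left mult_diff_right

lemma mult_antisym: "mult x y = - mult y x"
proof -
  have "mult (x + y) (x + y) = mult x x + mult x y + (mult y x + mult y y)"
    by (simp only: mult_add_left mult_add_right add_ac)
  then show ?thesis
    by (simp only: mult_alternating eq_neg_iff_add_eq_0 add_0_left add_0_right)
qed

lemma triple_swap12: "form (mult b a) c = - form (mult a b) c"
  by (metis mult_antisym form_minus_left)

lemma triple_swap23: "form (mult a c) b = - form (mult a b) c"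
  using triple_swap12 form_mult_cyclic by metis

lemma triple_repeat [simp]:
  "form (mult a a) b = 0" "form (mult a b) a = 0" "form (mult b a) a = 0"
  by (metis mult_alternating form_zero(1) form_mult_cyclic)+

lemma eqI_form: "(\<And>w. form u w = form v w) \<Longrightarrow> u = v"
  using form_nondegenerate[of "u - v"] by (simp add: form_diff_left)

lemma form_eq_on_span:
  assumes "\<And>b. b \<in> B \<Longrightarrow> form u b = form v b" "span B = UNIV"
  shows "u = v"
proof (rule eqI_form)
  fix w have "w \<in> span B" using assms(2) by simp
  then show "form u w = form v w"
    by (induction rule: span_induct_alt) (simp_all add: form_bilinear assms(1))
qed

text \<open>\<open>finite_dimensional_vector_space\<close> fixes a basis; interpreting it at such a
  \<open>B\<close> inside a proof gives access to its results.\<close>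

lemma exists_basis: "\<exists>B. finite_dimensional_vector_space scale B"
proof -
  obtain A where A: "finite A" "span A = UNIV" using finite_dim by blast
  obtain B where B: "B \<subseteq> A" "independent B" "A \<subseteq> span B"
    using maximal_independent_subset[of A] by blast
  have "span B = UNIV"
    using A(2) B(3) span_minimal[OF B(3) subspace_span] by auto
  then have "finite_dimensional_vector_space scale B"
    by unfold_locales (use A(1) B finite_subset in auto)
  then show ?thesis ..
qed

text \<open>The non-degenerate form identifies L with its dual, so values on a basis can be
  prescribed. All vectors dual to given products come from here.\<close>

lemma exists_perp_not_perp:
  assumes "subspace S" "x \<notin> S"
  shows "\<exists>v. (\<forall>s\<in>S. form s v = 0) \<and> form x v = 1"
proof -
  obtain B where "finite_dimensional_vector_space scale B" using exists_basis by blast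
  then interpret fd: finite_dimensional_vector_space scale B .
  obtain C where C: "C \<subseteq> S" "independent C" "S \<subseteq> span C"
    using maximal_independent_subset by blast
  have spC: "span C = S" using C assms(1) by (simp add: span_subspace)
  have iC: "independent (insert x C)"
    using C(2) assms(2) spC by (simp add: independent_insert)
  define D where "D = extend_basis (insert x C)"
  have D: "insert x C \<subseteq> D" "independent D" "span D = UNIV"
    unfolding D_def
    using extend_basis_superset[OF iC] independent_extend_basis[OF iC] span_extend_basis[OF iC]
    by auto
  have finD: "finite D" using D(2) fd.finiteI_independent by blast
  \<comment> \<open>\<open>g\<close> encodes the values of \<open>v\<close> against
    \<open>D\<close>; non-degeneracy makes it injective, hence surjective. A preimage of
    \<open>x\<close> has value 1 at \<open>x\<close> and 0 at the other elements of
    \<open>D\<close>.\<close>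
  define g where "g v = (\<Sum>b\<in>D. scale (form b v) b)" for v
  have coeff: "(\<forall>b\<in>D. form b v = c b)" if "g v = (\<Sum>b\<in>D. scale (c b) b)" for v c
  proof
    fix b assume "b \<in> D"
    have "(\<Sum>b\<in>D. scale (form b v - c b) b) = 0"
      using that by (simp add: g_def scale_left_diff_distrib sum_subtractf)
    then show "form b v = c b"
      using independentD[OF D(2) finD subset_refl _ \<open>b \<in> D\<close>, of "\<lambda>b. form b v - c b"] by simp
  qed
  have lin: "Vector_Spaces.linear scale scale g"
    by unfold_locales
      (simp_all add: g_def form_bilinear scale_left_distrib sum.distrib scale_sum_right)
  interpret g: Vector_Spaces.linear scale scale g by (rule lin)
  have "inj g"
    unfolding g.inj_iff_eq_0
  proof (intro allI impI)
    fix v assume "g v = 0"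
    then have "\<forall>b\<in>D. form b v = 0" by (intro coeff) simp
    then show "v = 0"
      using form_eq_on_span[of D v 0] D(3) form_antisym by (metis form_zero(1) neg_equal_0_iff_equal)
  qed
  then have "surj g" by (rule fd.linear_inj_imp_surj[OF lin])
  then obtain v where "g v = x" by (metis surjD)
  moreover have "x = (\<Sum>b\<in>D. scale (if b = x then 1 else 0) b)"
    using D(1) finD by (simp add: if_distrib[of "\<lambda>r. scale r _"] cong: if_cong)
  ultimately have *: "\<forall>b\<in>D. form b v = (if b = x then 1 else 0)" by (intro coeff) simp
  have "form s v = 0" if "s \<in> S" for s
  proof -
    have "s \<in> span C" using that spC by simp
    then show ?thesis
    proof (induction rule: span_induct_alt)
      case (step c b s)
      then have "b \<noteq> x" using C(1) assms(2) by auto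
      with step show ?case using * D(1) by (auto simp: form_bilinear)
    qed simp
  qed
  then show ?thesis using * D(1) by (intro exI[of _ v]) auto
qed

end

text \<open>Keeps the simplifier from turning the basis vector \<open>x 1\<close> into \<open>x (Suc 0)\<close>.\<close>

declare One_nat_def [simp del]

lemma atLeastAtMost_1_5: "{1..5::nat} = {1, 2, 3, 4, 5}"
  by auto

section \<open>Orthogonality to the center, permuted triples and standard bases\<close>

context saa
begin

lemma form_mult_center: "z \<in> center \<Longrightarrow> form (mult u v) z = 0" "z \<in> center \<Longrightarrow> form z (mult u v) = 0"
proof -
  show *: "form (mult u v) z = 0" if "z \<in> center" for z
    using that form_mult_cyclic[of u v z] form_mult_cyclic[of v z u]
    by (simp add: mult_zero_if_center)
  show "form z (mult u v) = 0" if "z \<in> center" for z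
    using *[OF that] form_antisym[of z "mult u v"] by simp
qed

lemma form_center_perp:
  assumes "z \<in> center" "w \<in> lower_power 2"
  shows "form z w = 0" "form w z = 0"
  using form_center_lower_power_2[OF assms(2,1)] form_antisym[of z w] by auto

lemma mult_center_right: "z \<in> center \<Longrightarrow> mult u z = 0"
  using mult_antisym[of u z] by (simp add: mult_zero_if_center)

lemma mult_swap: "mult u v = w \<Longrightarrow> mult v u = - w"
  using mult_antisym by metis

lemma triple_perms:
  assumes "form (mult u v) w = c"
  shows "form (mult v w) u = c" "form (mult w u) v = c"
    "form (mult v u) w = - c" "form (mult u w) v = - c" "form (mult w v) u = - c"
  using assms triple_swap12 triple_swap23 form_mult_cyclic by metis+

text \<open>Pairing a linear relation with \<open>y i\<close> isolates the coefficient of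
  \<open>x i\<close>, and conversely.\<close>

lemma independent_symplectic:
  fixes I :: "'i set"
  assumes fin: "finite I"
    and xx: "\<And>i j. i \<in> I \<Longrightarrow> j \<in> I \<Longrightarrow> form (x i) (x j) = 0"
    and yy: "\<And>i j. i \<in> I \<Longrightarrow> j \<in> I \<Longrightarrow> form (y i) (y j) = 0"
    and xy: "\<And>i j. i \<in> I \<Longrightarrow> j \<in> I \<Longrightarrow> form (x i) (y j) = (if i = j then 1 else 0)"
  shows "card (x ` I \<union> y ` I) = 2 * card I" "independent (x ` I \<union> y ` I)"
proof -
  have yx: "form (y j) (x i) = - (if i = j then 1 else 0)" if "i \<in> I" "j \<in> I" for i j
    using xy[OF that] form_antisym[of "y j" "x i"] by simp
  have inj: "inj_on x I" "inj_on y I"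
    using xy by (auto simp: inj_on_def) (metis zero_neq_one)+
  have disj: "x ` I \<inter> y ` I = {}"
    using xx xy by (auto) (metis zero_neq_one)
  show "card (x ` I \<union> y ` I) = 2 * card I"
    using inj disj fin by (simp add: card_Un_disjoint card_image)
  show "independent (x ` I \<union> y ` I)"
  proof (rule independent_if_scalars_zero)
    fix c v
    assume "(\<Sum>b\<in>x ` I \<union> y ` I. scale (c b) b) = 0" and v: "v \<in> x ` I \<union> y ` I"
    then have "(\<Sum>i\<in>I. scale (c (x i)) (x i)) + (\<Sum>i\<in>I. scale (c (y i)) (y i)) = 0"
      using inj disj fin by (simp add: sum.union_disjoint sum.reindex)
    then have *: "form ((\<Sum>i\<in>I. scale (c (x i)) (x i)) + (\<Sum>i\<in>I. scale (c (y i)) (y i))) w = 0" for w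
      by simp
    have "c (x i) = 0" if "i \<in> I" for i
      using *[of "y i"] that fin
      by (simp add: form_add_left form_sum_left form_scale_left xy yy if_distrib[of "(*) _"] cong: sum.cong if_cong)
    moreover have "c (y i) = 0" if "i \<in> I" for i
      using *[of "x i"] that fin
      by (simp add: form_add_left form_sum_left form_scale_left xx yx sum_negf if_distrib[of "(*) _"] cong: sum.cong if_cong)
    ultimately show "c v = 0" using v by auto
  qed (use fin in auto)
qed

lemma standard_basis_if_span:
  assumes "\<And>i j. i \<in> {1..5} \<Longrightarrow> j \<in> {1..5} \<Longrightarrow>
      form (x i) (x j) = 0 \<and> form (y i) (y j) = 0 \<and> form (x i) (y j) = (if i = j then 1 else 0)"
    and "span (x ` {1..5} \<union> y ` {1..5}) = UNIV"
  shows "standard_basis x y"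
  unfolding standard_basis_def
  using assms independent_symplectic[of "{1..5}" x y] by simp

lemma standard_basis_if_dim:
  assumes gram: "\<And>i j. i \<in> {1..5} \<Longrightarrow> j \<in> {1..5} \<Longrightarrow>
      form (x i) (x j) = 0 \<and> form (y i) (y j) = 0 \<and> form (x i) (y j) = (if i = j then 1 else 0)"
    and dim: "dim UNIV = 10"
  shows "standard_basis x y"
proof -
  obtain B where "finite_dimensional_vector_space scale B" using exists_basis by blast
  then interpret fd: finite_dimensional_vector_space scale B .
  have "card (x ` {1..5} \<union> y ` {1..5}) = 10" and ind: "independent (x ` {1..5} \<union> y ` {1..5})"
    using gram independent_symplectic[of "{1..5}" x y] by simp_all
  then have "UNIV \<subseteq> span (x ` {1..5} \<union> y ` {1..5})"
    using dim by (intro fd.card_ge_dim_independent) auto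
  with gram show ?thesis by (intro standard_basis_if_span) auto
qed

lemma standard_basis_form:
  assumes "standard_basis x y" "i \<in> {1..5}" "j \<in> {1..5}"
  shows "form (x i) (x j) = 0" "form (y i) (y j) = 0"
    "form (x i) (y j) = (if i = j then 1 else 0)" "form (y j) (x i) = (if i = j then - 1 else 0)"
  using assms form_antisym[of "y j" "x i"] by (auto simp: standard_basis_def)

lemma standard_basis_eqI:
  assumes "standard_basis x y"
    and "\<And>i. i \<in> {1..5} \<Longrightarrow> form u (x i) = form v (x i)"
    and "\<And>i. i \<in> {1..5} \<Longrightarrow> form u (y i) = form v (y i)"
  shows "u = v"
  by (rule form_eq_on_span[of "x ` {1..5} \<union> y ` {1..5}"])
    (use assms in \<open>auto simp: standard_basis_def\<close>)

lemma standard_basis_eqI_explicit: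
  assumes "standard_basis x y"
    and "form u (x 1) = form v (x 1)" "form u (x 2) = form v (x 2)"
      "form u (x 3) = form v (x 3)" "form u (x 4) = form v (x 4)" "form u (x 5) = form v (x 5)"
      "form u (y 1) = form v (y 1)" "form u (y 2) = form v (y 2)"
      "form u (y 3) = form v (y 3)" "form u (y 4) = form v (y 4)" "form u (y 5) = form v (y 5)"
  shows "u = v"
  by (rule standard_basis_eqI[OF assms(1)]) (use assms in \<open>auto simp: atLeastAtMost_1_5\<close>)

lemma standard_basis_expand:
  assumes "standard_basis x y"
  shows "v = scale (form v (y 1)) (x 1) + scale (form v (y 2)) (x 2) + scale (form v (y 3)) (x 3)
      + scale (form v (y 4)) (x 4) + scale (form v (y 5)) (x 5)
      + scale (form (x 1) v) (y 1) + scale (form (x 2) v) (y 2) + scale (form (x 3) v) (y 3)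
      + scale (form (x 4) v) (y 4) + scale (form (x 5) v) (y 5)"
  by (rule standard_basis_eqI_explicit[OF assms])
    (simp_all add: form_bilinear standard_basis_form[OF assms] form_antisym[of v "x _"])

end

section \<open>The presented algebras\<close>

text \<open>
  The multiplication table behind \<open>P10_44\<close>: a product \<open>uv\<close> of basis vectors is read off from
  its values \<open>(uv, w)\<close> at the dual basis vectors.
\<close>

locale saa_P10_44 = saa scale form mult
  for scale :: "'f::field \<Rightarrow> 'v::ab_group_add \<Rightarrow> 'v" and form mult +
  fixes x y :: "nat \<Rightarrow> 'v" and \<alpha> \<beta> :: 'f
  assumes basis: "standard_basis x y"
    and central: "x 2 \<in> center" "x 3 \<in> center" "x 4 \<in> center" "x 5 \<in> center"
    and mult_x1_y: "mult (x 1) (y 1) = 0" "mult (x 1) (y 2) = x 3"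
      "mult (x 1) (y 3) = scale \<alpha> (x 4) - x 2"
      "mult (x 1) (y 4) = scale \<beta> (x 5) - scale \<alpha> (x 3)"
      "mult (x 1) (y 5) = - scale \<beta> (x 4)"
    and mult_y1_y: "mult (y 1) (y 2) = x 5" "mult (y 1) (y 3) = x 4"
      "mult (y 1) (y 4) = - x 3" "mult (y 1) (y 5) = - x 2"
    and mult_y_y: "mult (y 2) (y 3) = - y 1" "mult (y 2) (y 4) = 0" "mult (y 2) (y 5) = x 1"
      "mult (y 3) (y 4) = x 1 - scale \<alpha> (y 1)" "mult (y 3) (y 5) = 0"
      "mult (y 4) (y 5) = - scale \<beta> (y 1)"
begin

lemma gram: "i \<in> {1..5} \<Longrightarrow> j \<in> {1..5} \<Longrightarrow> form (x i) (x j) = 0"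
    "i \<in> {1..5} \<Longrightarrow> j \<in> {1..5} \<Longrightarrow> form (y i) (y j) = 0"
    "i \<in> {1..5} \<Longrightarrow> j \<in> {1..5} \<Longrightarrow> form (x i) (y j) = (if i = j then 1 else 0)"
    "i \<in> {1..5} \<Longrightarrow> j \<in> {1..5} \<Longrightarrow> form (y j) (x i) = (if i = j then - 1 else 0)"
  using standard_basis_form[OF basis] by blast+

lemmas mult_forward = mult_x1_y mult_y1_y mult_y_y

lemmas mult_table = mult_forward
  mult_forward[THEN mult_swap]
  central[THEN mult_zero_if_center] central[THEN mult_center_right] mult_alternating


lemma has_presentation: "has_presentation (P10_44 \<alpha> \<beta>)"
proof -
  let ?e = "case_basis_index x y"
  have listed: "\<forall>((p, q, r), c) \<in> P10_44 \<alpha> \<beta>. form (mult (?e p) (?e q)) (?e r) = c"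
    by (simp add: P10_44_def mult_table form_bilinear gram)
  have "form (mult (?e p) (?e q)) (?e r) = 0"
    if "p \<in> X ` {1..5} \<union> Y ` {1..5}" "q \<in> X ` {1..5} \<union> Y ` {1..5}" "r \<in> X ` {1..5} \<union> Y ` {1..5}"
      and "\<forall>((p', q', r'), c) \<in> P10_44 \<alpha> \<beta>. {p, q, r} \<noteq> {p', q', r'}" for p q r
  proof (rule ccontr)
    assume nz: "form (mult (?e p) (?e q)) (?e r) \<noteq> 0"
    \<comment> \<open>A nonzero triple has no central entry, so only six basis vectors remain and
      the cases can be checked one by one.\<close>
    have red: "s \<in> {X 1, Y 1, Y 2, Y 3, Y 4, Y 5}"
      if "s \<in> X ` {1..5} \<union> Y ` {1..5}" "?e s \<notin> center" for s
      using that central by (auto simp: atLeastAtMost_1_5)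
    have "?e p \<notin> center" "?e q \<notin> center" "?e r \<notin> center"
      using nz by (auto simp: mult_zero_if_center mult_center_right form_mult_center)
    then have "p \<in> {X 1, Y 1, Y 2, Y 3, Y 4, Y 5}" "q \<in> {X 1, Y 1, Y 2, Y 3, Y 4, Y 5}"
      "r \<in> {X 1, Y 1, Y 2, Y 3, Y 4, Y 5}"
      using red that(1-3) by blast+
    then have "{p, q, r} \<in> {{X 1, Y 2, Y 3}, {X 1, Y 3, Y 4}, {X 1, Y 4, Y 5}, {Y 1, Y 2, Y 5}, {Y 1, Y 3, Y 4}}"
      using nz by (elim insertE emptyE; hypsubst; simp add: mult_table form_bilinear gram insert_commute)
    then show False
      using that(4) by (auto simp: P10_44_def)
  qed
  with listed basis show ?thesis
    unfolding has_presentation_def by (intro exI[of _ x] exI[of _ y]) (simp add: Let_def)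
qed

end

text \<open>\<open>x 2\<close>, ..., \<open>x 5\<close> occur in no listed triple, hence are
  central. Each remaining product is recovered from its pairings with the standard basis.\<close>

lemma (in saa) saa_P10_44_if_presentation:
  assumes "has_presentation (P10_44 \<alpha> \<beta>)"
  shows "\<exists>x y. saa_P10_44 scale form mult x y \<alpha> \<beta>"
proof -
  obtain x y where basis: "standard_basis x y"
    and listed: "\<forall>((p, q, r), c) \<in> P10_44 \<alpha> \<beta>.
        form (mult (case_basis_index x y p) (case_basis_index x y q)) (case_basis_index x y r) = c"
    and unlisted: "\<forall>p\<in>X ` {1..5} \<union> Y ` {1..5}. \<forall>q\<in>X ` {1..5} \<union> Y ` {1..5}. \<forall>r\<in>X ` {1..5} \<union> Y ` {1..5}.
          (\<forall>((p', q', r'), c) \<in> P10_44 \<alpha> \<beta>. {p, q, r} \<noteq> {p', q', r'}) \<longrightarrow>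
          form (mult (case_basis_index x y p) (case_basis_index x y q)) (case_basis_index x y r) = 0"
    using assms unfolding has_presentation_def Let_def by blast
  let ?e = "case_basis_index x y" and ?I = "X ` {1..5} \<union> Y ` {1..5}"
  \<comment> \<open>Non-inclusion of the listed index sets implies that they differ from
    \<open>{p, q, r}\<close> and reduces to membership tests, which the simplifier decides.\<close>
  have zero: "form (mult (?e p) (?e q)) (?e r) = 0"
    if "p \<in> ?I" "q \<in> ?I" "r \<in> ?I"
      "\<not> {X 1, Y 2, Y 3} \<subseteq> {p, q, r}" "\<not> {X 1, Y 3, Y 4} \<subseteq> {p, q, r}"
      "\<not> {X 1, Y 4, Y 5} \<subseteq> {p, q, r}" "\<not> {Y 1, Y 2, Y 5} \<subseteq> {p, q, r}"
      "\<not> {Y 1, Y 3, Y 4} \<subseteq> {p, q, r}" for p q r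
  proof -
    have "\<forall>((p', q', r'), c) \<in> P10_44 \<alpha> \<beta>. \<not> {p', q', r'} \<subseteq> {p, q, r}"
      using that(4-) by (simp add: P10_44_def del: insert_subset)
    then have "\<forall>((p', q', r'), c) \<in> P10_44 \<alpha> \<beta>. {p, q, r} \<noteq> {p', q', r'}"
      by (auto simp del: insert_subset)
    then show ?thesis using unlisted that(1-3) by blast
  qed
  have central: "x i \<in> center" if i: "i \<in> {2..5}" for i
  proof -
    have I: "X i \<in> ?I" using i by auto
    have *: "form (mult (x i) (?e q)) (?e r) = 0" if "q \<in> ?I" "r \<in> ?I" for q r
    proof -
      have "form (mult (?e (X i)) (?e q)) (?e r) = 0"
        by (rule zero[OF I that]) (use i in auto)
      then show ?thesis by simp
    qed
    have "mult (x i) (?e q) = 0" if "q \<in> ?I" for q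
      by (rule standard_basis_eqI[OF basis]) (use *[OF that, of "X _"] *[OF that, of "Y _"] in auto)
    \<comment> \<open>Cyclicity moves the arbitrary \<open>w\<close> into the last slot, so
      vanishing on basis vectors extends to all of L.\<close>
    then have **: "form (mult w (x i)) (?e q) = 0" if "q \<in> ?I" for q w
      using that form_mult_cyclic[of w "x i" "?e q"] by simp
    have "mult w (x i) = 0" for w
      by (rule standard_basis_eqI[OF basis]) (use **[of "X _"] **[of "Y _"] in auto)
    then show ?thesis using mult_antisym[of "x i"] by (simp add: center_def)
  qed
  have vals: "form (mult (x 1) (y 2)) (y 3) = 1" "form (mult (x 1) (y 3)) (y 4) = \<alpha>"
    "form (mult (x 1) (y 4)) (y 5) = \<beta>" "form (mult (y 1) (y 2)) (y 5) = 1"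
    "form (mult (y 1) (y 3)) (y 4) = 1"
    using listed by (simp_all add: P10_44_def)
  have zeros: "form (mult (x 1) (y 1)) (y 2) = 0" "form (mult (x 1) (y 1)) (y 3) = 0"
    "form (mult (x 1) (y 1)) (y 4) = 0" "form (mult (x 1) (y 1)) (y 5) = 0"
    "form (mult (x 1) (y 2)) (y 4) = 0" "form (mult (x 1) (y 2)) (y 5) = 0"
    "form (mult (x 1) (y 3)) (y 5) = 0"
    "form (mult (y 1) (y 2)) (y 3) = 0" "form (mult (y 1) (y 2)) (y 4) = 0"
    "form (mult (y 1) (y 3)) (y 5) = 0" "form (mult (y 1) (y 4)) (y 5) = 0"
    "form (mult (y 2) (y 3)) (y 4) = 0" "form (mult (y 2) (y 3)) (y 5) = 0"
    "form (mult (y 2) (y 4)) (y 5) = 0" "form (mult (y 3) (y 4)) (y 5) = 0"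
    using zero[of "X 1" "Y 1" "Y 2"] zero[of "X 1" "Y 1" "Y 3"] zero[of "X 1" "Y 1" "Y 4"]
      zero[of "X 1" "Y 1" "Y 5"] zero[of "X 1" "Y 2" "Y 4"] zero[of "X 1" "Y 2" "Y 5"]
      zero[of "X 1" "Y 3" "Y 5"] zero[of "Y 1" "Y 2" "Y 3"] zero[of "Y 1" "Y 2" "Y 4"]
      zero[of "Y 1" "Y 3" "Y 5"] zero[of "Y 1" "Y 4" "Y 5"] zero[of "Y 2" "Y 3" "Y 4"]
      zero[of "Y 2" "Y 3" "Y 5"] zero[of "Y 2" "Y 4" "Y 5"] zero[of "Y 3" "Y 4" "Y 5"]
    by (simp_all add: image_iff)
  have cen: "x 2 \<in> center" "x 3 \<in> center" "x 4 \<in> center" "x 5 \<in> center"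
    using central by simp_all
  note T = vals zeros
  note form_simps = T T[THEN triple_perms(1)] T[THEN triple_perms(2)] T[THEN triple_perms(3)]
    T[THEN triple_perms(4)] T[THEN triple_perms(5)]
    cen[THEN form_mult_center(1)] form_bilinear standard_basis_form[OF basis]
  have "saa_P10_44 scale form mult x y \<alpha> \<beta>"
  proof unfold_locales
    show "standard_basis x y" by (fact basis)
    show "x 2 \<in> center" "x 3 \<in> center" "x 4 \<in> center" "x 5 \<in> center"
      by (fact cen)+
  qed (rule standard_basis_eqI_explicit[OF basis], simp_all add: form_simps)+
  then show ?thesis by blast
qed

section \<open>Center and lower powers in general\<close>

context saa
begin

lemma subspace_center: "subspace center"
  by (auto simp: subspace_def center_def mult_bilinear)

lemma subspace_set_product: "subspace (set_product U V)"
  by (simp add: set_product_def)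

lemma set_product_subset:
  assumes "subspace W" "\<And>u v. u \<in> U \<Longrightarrow> v \<in> V \<Longrightarrow> mult u v \<in> W"
  shows "set_product U V \<subseteq> W"
  unfolding set_product_def using assms by (intro span_minimal) auto

lemma mult_in_set_product: "u \<in> U \<Longrightarrow> v \<in> V \<Longrightarrow> mult u v \<in> set_product U V"
  unfolding set_product_def by (intro span_base) blast

lemma subspace_lower_power_2: "subspace (lower_power 2)"
  by (simp add: lower_power_2_eq subspace_set_product)

lemma mult_in_lower_power_2: "mult u v \<in> lower_power 2"
  by (simp add: lower_power_2_eq mult_in_set_product)

lemma mult_in_lower_power_3: "u \<in> lower_power 2 \<Longrightarrow> mult u v \<in> lower_power 3"
  by (simp add: lower_power_3_eq mult_in_set_product)

text \<open>By cyclicity \<open>(zu, w) = (uw, z)\<close>, a pairing of \<open>z\<close> with an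
  element of L^2.\<close>

lemma center_if_perp_lower_power_2:
  assumes "\<And>w. w \<in> lower_power 2 \<Longrightarrow> form w z = 0"
  shows "z \<in> center"
proof -
  have "mult z u = 0" for u
    by (rule eqI_form) (use assms[OF mult_in_lower_power_2] form_mult_cyclic in \<open>metis form_zero(1)\<close>)
  then show ?thesis by (simp add: center_def)
qed

end

section \<open>Center, lower powers and type C of the presented algebras\<close>

context saa_P10_44
begin

lemma expand:
  "v = scale (form v (y 1)) (x 1) + scale (form v (y 2)) (x 2) + scale (form v (y 3)) (x 3)
      + scale (form v (y 4)) (x 4) + scale (form v (y 5)) (x 5)
      + scale (form (x 1) v) (y 1) + scale (form (x 2) v) (y 2) + scale (form (x 3) v) (y 3)
      + scale (form (x 4) v) (y 4) + scale (form (x 5) v) (y 5)"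
  by (rule standard_basis_expand[OF basis])

lemma mult_x1:
  "mult (x 1) u = scale (form (x 2) u) (x 3) + scale (form (x 3) u) (scale \<alpha> (x 4) - x 2)
    + scale (form (x 4) u) (scale \<beta> (x 5) - scale \<alpha> (x 3)) - scale (form (x 5) u * \<beta>) (x 4)"
  using arg_cong[OF expand[of u], of "mult (x 1)"] by (simp add: mult_bilinear mult_table)

lemma mult_y1:
  "mult (y 1) u = scale (form (x 2) u) (x 5) + scale (form (x 3) u) (x 4)
    - scale (form (x 4) u) (x 3) - scale (form (x 5) u) (x 2)"
  using arg_cong[OF expand[of u], of "mult (y 1)"] by (simp add: mult_bilinear mult_table)

lemma basis_in_lower_power_2:
  "x 1 \<in> lower_power 2" "x 2 \<in> lower_power 2" "x 3 \<in> lower_power 2" "x 4 \<in> lower_power 2"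
  "x 5 \<in> lower_power 2" "y 1 \<in> lower_power 2"
proof -
  have neg: "w \<in> lower_power 2" if "mult u v = - w" for u v w
    using subspace_neg[OF subspace_lower_power_2 mult_in_lower_power_2[of u v]] that by simp
  show "x 1 \<in> lower_power 2" "x 3 \<in> lower_power 2" "x 4 \<in> lower_power 2" "x 5 \<in> lower_power 2"
    using mult_in_lower_power_2 mult_x1_y(2) mult_y1_y(1,2) mult_y_y(3) by metis+
  show "x 2 \<in> lower_power 2" "y 1 \<in> lower_power 2"
    using neg mult_y1_y(4) mult_y_y(1) by blast+
qed

text \<open>The four values are the coefficients of \<open>y 2\<close>, ..., \<open>y 5\<close>.
  They vanish on L^2 because it is orthogonal to the center; the other six basis vectors are
  products up to sign.\<close>

lemma mem_lower_power_2_iff: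
  "v \<in> lower_power 2 \<longleftrightarrow>
    form (x 2) v = 0 \<and> form (x 3) v = 0 \<and> form (x 4) v = 0 \<and> form (x 5) v = 0"
proof
  assume "v \<in> lower_power 2"
  then have "form v z = 0" if "z \<in> center" for z
    using that by (rule form_center_lower_power_2)
  then show "form (x 2) v = 0 \<and> form (x 3) v = 0 \<and> form (x 4) v = 0 \<and> form (x 5) v = 0"
    using central form_antisym by (metis neg_equal_0_iff_equal)
next
  assume *: "form (x 2) v = 0 \<and> form (x 3) v = 0 \<and> form (x 4) v = 0 \<and> form (x 5) v = 0"
  show "v \<in> lower_power 2"
    by (subst expand)
      (simp add: * basis_in_lower_power_2 subspace_add[OF subspace_lower_power_2]
        subspace_scale[OF subspace_lower_power_2])
qed

lemma mem_center_iff: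
  "z \<in> center \<longleftrightarrow> form (x 1) z = 0 \<and> form (x 2) z = 0 \<and> form (x 3) z = 0 \<and> form (x 4) z = 0
    \<and> form (x 5) z = 0 \<and> form z (y 1) = 0"
proof
  assume "z \<in> center"
  then have "form w z = 0" "form z w = 0" if "w \<in> lower_power 2" for w
    using that form_center_lower_power_2 form_antisym[of z w] by simp_all
  then show "form (x 1) z = 0 \<and> form (x 2) z = 0 \<and> form (x 3) z = 0 \<and> form (x 4) z = 0
    \<and> form (x 5) z = 0 \<and> form z (y 1) = 0"
    using basis_in_lower_power_2 by blast
next
  assume *: "form (x 1) z = 0 \<and> form (x 2) z = 0 \<and> form (x 3) z = 0 \<and> form (x 4) z = 0
    \<and> form (x 5) z = 0 \<and> form z (y 1) = 0"
  show "z \<in> center"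
    by (subst expand)
      (simp add: * central subspace_add[OF subspace_center] subspace_scale[OF subspace_center])
qed

lemma center_eq_span: "center = span (x ` {2..5})"
proof
  show "span (x ` {2..5}) \<subseteq> center"
  proof (rule span_minimal[OF _ subspace_center])
    have "{2..5::nat} = {2, 3, 4, 5}" by auto
    then show "x ` {2..5} \<subseteq> center" using central by auto
  qed
  show "center \<subseteq> span (x ` {2..5})"
  proof
    fix z assume "z \<in> center"
    then have *: "form (x 1) z = 0 \<and> form (x 2) z = 0 \<and> form (x 3) z = 0 \<and> form (x 4) z = 0
      \<and> form (x 5) z = 0 \<and> form z (y 1) = 0"
      by (simp only: mem_center_iff)
    show "z \<in> span (x ` {2..5})"
      by (subst expand) (simp add: * span_add span_scale span_base)
  qed
qed

lemma dim_center: "dim center = 4"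
proof -
  have "independent (x ` {2..5})"
    using basis unfolding standard_basis_def
    by (elim conjE) (rule independent_mono, auto)
  moreover have "card (x ` {2..5}) = 4"
  proof -
    have "inj_on x {2..5}"
      by (rule inj_onI) (metis (no_types, lifting) gram(3) atLeastAtMost_iff le_trans one_le_numeral zero_neq_one)
    then show ?thesis by (simp add: card_image)
  qed
  ultimately show ?thesis
    by (simp add: center_eq_span dim_span dim_eq_card_independent)
qed

lemma lower_power_2_decomp:
  assumes "v \<in> lower_power 2"
  shows "\<exists>z\<in>center. v = scale (form v (y 1)) (x 1) + scale (form (x 1) v) (y 1) + z"
proof
  let ?z = "v - (scale (form v (y 1)) (x 1) + scale (form (x 1) v) (y 1))"
  show "?z \<in> center"
    using assms by (auto simp: mem_center_iff mem_lower_power_2_iff form_bilinear gram)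
qed simp

lemma mult_lower_power_2: "u \<in> lower_power 2 \<Longrightarrow> v \<in> lower_power 2 \<Longrightarrow> mult u v = 0"
proof -
  assume "u \<in> lower_power 2" "v \<in> lower_power 2"
  then obtain a b z a' b' z' where "z \<in> center" "z' \<in> center"
    "u = scale a (x 1) + scale b (y 1) + z" "v = scale a' (x 1) + scale b' (y 1) + z'"
    using lower_power_2_decomp by blast
  then show ?thesis
    by (simp add: mult_bilinear mult_table mult_zero_if_center mult_center_right)
qed

lemma lower_power_3_eq_center: "lower_power 3 = center"
proof
  show "lower_power 3 \<subseteq> center"
    unfolding lower_power_3_eq
  proof (rule set_product_subset[OF subspace_center])
    fix u v assume u: "u \<in> lower_power 2"
    show "mult u v \<in> center"
    proof (rule center_if_perp_lower_power_2)
      fix w assume "w \<in> lower_power 2"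
      \<comment> \<open>Up to sign this is \<open>(wu, v)\<close>, and L^2 is abelian.\<close>
      then show "form w (mult u v) = 0"
        using mult_lower_power_2[of w u] u form_mult_cyclic[of w u v] form_antisym[of w "mult u v"]
        by simp
    qed
  qed
  have sub: "subspace (lower_power 3)"
    by (simp add: lower_power_3_eq subspace_set_product)
  \<comment> \<open>Up to sign, each of these is a product with a factor \<open>x 1\<close> or
    \<open>y 1\<close>, which lies in L^2.\<close>
  have "x 2 \<in> lower_power 3" "x 3 \<in> lower_power 3" "x 4 \<in> lower_power 3" "x 5 \<in> lower_power 3"
    using mult_in_lower_power_3[OF basis_in_lower_power_2(1), of "y 2"]
      mult_in_lower_power_3[OF basis_in_lower_power_2(6)]
      subspace_neg[OF sub mult_in_lower_power_3[OF basis_in_lower_power_2(6)], of "y 5"]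
    by (simp_all add: mult_table) (metis mult_y1_y)+
  moreover have "{2..5::nat} = {2, 3, 4, 5}" by auto
  ultimately show "center \<subseteq> lower_power 3"
    unfolding center_eq_span using sub by (intro span_minimal) auto
qed

lemma nilpotent: "nilpotent"
proof -
  have "lower_power 4 = set_product (lower_power 3) UNIV"
    by (simp add: lower_power_def numeral_Bit0 One_nat_def numeral_3_eq_3)
  also have "\<dots> \<subseteq> {0}"
    by (rule set_product_subset) (simp_all add: lower_power_3_eq_center mult_zero_if_center)
  finally have "lower_power 4 = {0}"
    using subspace_0[OF subspace_set_product] \<open>lower_power 4 = set_product (lower_power 3) UNIV\<close> by auto
  then show ?thesis
    unfolding nilpotent_def by (intro exI[of _ 3]) simp
qed

text \<open>The Pfaffian of the pencil \<open>s \<phi>\<^bsub>x 1\<^esub> + t \<phi>\<^bsub>y 1\<^esub>\<close> is \<open>t\<^sup>2 + \<alpha> s t + \<beta> s\<^sup>2\<close>.\<close>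

lemma pfaffian_nonzero:
  assumes "irreducible [:\<beta>, \<alpha>, 1:]" "s \<noteq> 0 \<or> t \<noteq> 0"
  shows "t\<^sup>2 + \<alpha> * s * t + \<beta> * s\<^sup>2 \<noteq> 0"
proof (cases "s = 0")
  case False
  have "(t / s)\<^sup>2 + \<alpha> * (t / s) + \<beta> \<noteq> 0"
    using assms(1) unfolding irreducible_monic_quadratic_iff by blast
  moreover have "(t / s)\<^sup>2 + \<alpha> * (t / s) + \<beta> = (t\<^sup>2 + \<alpha> * s * t + \<beta> * s\<^sup>2) / s\<^sup>2"
    using False by (simp add: field_simps power2_eq_square)
  ultimately show ?thesis by auto
qed (use assms in auto)

text \<open>Pairing with \<open>y 2\<close>, ..., \<open>y 5\<close> gives a linear system for the
  coordinates of \<open>u\<close> modulo L^2. It splits into two systems of size 2, each with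
  determinant plus or minus the Pfaffian.\<close>

lemma mem_lower_power_2_if_mult_zero:
  assumes "irreducible [:\<beta>, \<alpha>, 1:]" "s \<noteq> 0 \<or> t \<noteq> 0"
    and "mult (scale s (x 1) + scale t (y 1)) u = 0"
  shows "u \<in> lower_power 2"
proof -
  define Q where "Q = t\<^sup>2 + \<alpha> * s * t + \<beta> * s\<^sup>2"
  have Q: "Q \<noteq> 0" unfolding Q_def by (rule pfaffian_nonzero[OF assms(1,2)])
  have *: "form (scale s (mult (x 1) u) + scale t (mult (y 1) u)) w = 0" for w
    using assms(3) by (simp add: mult_add_left mult_scale_left)
  let ?b2 = "form (x 2) u" and ?b3 = "form (x 3) u" and ?b4 = "form (x 4) u" and ?b5 = "form (x 5) u"
  have 2: "- (s * ?b3) = t * ?b5"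
    using *[of "y 2"] by (simp add: mult_x1 mult_y1 form_bilinear gram algebra_simps)
  have 3: "s * ?b2 = (s * \<alpha> + t) * ?b4"
    using *[of "y 3"] by (simp add: mult_x1 mult_y1 form_bilinear gram algebra_simps)
  have 4: "(s * \<alpha> + t) * ?b3 = s * \<beta> * ?b5"
    using *[of "y 4"] by (simp add: mult_x1 mult_y1 form_bilinear gram algebra_simps)
  have 5: "t * ?b2 + s * \<beta> * ?b4 = 0"
    using *[of "y 5"] by (simp add: mult_x1 mult_y1 form_bilinear gram algebra_simps)
  have "Q * ?b2 = 0" "Q * ?b3 = 0" "Q * ?b4 = 0" "Q * ?b5 = 0"
    using 2 3 4 5 unfolding Q_def by algebra+
  then show ?thesis using Q by (simp add: mem_lower_power_2_iff)
qed

lemma dim_10: "dim UNIV = 10"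
  using basis dim_eq_card_independent dim_span by (metis standard_basis_def)

theorem saa_type_C:
  assumes "irreducible [:\<beta>, \<alpha>, 1:]"
  shows "saa_type_C scale form mult"
proof unfold_locales
  show "nilpotent" by (rule nilpotent)
  show "dim UNIV = 10" by (rule dim_10)
  \<comment> \<open>The center lies in L^2 and is orthogonal to L^2.\<close>
  show "isotropic center"
    unfolding isotropic_def
  proof (intro ballI form_center_lower_power_2)
    show "u \<in> lower_power 2" if "u \<in> center" for u
      using that by (simp add: mem_center_iff mem_lower_power_2_iff)
  qed
  show "dim center = 4" by (rule dim_center)
  show "lower_power 3 = center" by (rule lower_power_3_eq_center)
  show "type_C"
    unfolding type_C_def
  proof (intro ballI allI impI)
    fix z u assume z: "z \<in> lower_power 2 - center" and u: "\<forall>v. phi z u v = 0"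
    obtain c where c: "c \<in> center" "z = scale (form z (y 1)) (x 1) + scale (form (x 1) z) (y 1) + c"
      using z lower_power_2_decomp by blast
    have "form z (y 1) \<noteq> 0 \<or> form (x 1) z \<noteq> 0"
      using z c by auto
    moreover have "mult z u = 0"
      using u by (intro form_nondegenerate) (simp add: phi_def)
    then have "mult (scale (form z (y 1)) (x 1) + scale (form (x 1) z) (y 1)) u = 0"
      using arg_cong[OF c(2), of "\<lambda>z. mult z u"] c(1) by (simp add: mult_add_left mult_zero_if_center)
    ultimately show "u \<in> lower_power 2"
      by (intro mem_lower_power_2_if_mult_zero[OF assms]) auto
  qed
qed

end

section \<open>Existence of presentations\<close>

text \<open>
  Adding central elements changes no product, so a family with the right triple values can be
  corrected to a symplectic one; the remaining basis vectors are forced to be products.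
\<close>

lemma (in saa) saa_P10_44_from_triples:
  assumes dim: "dim UNIV = 10" and L3: "lower_power 3 = center"
    and a: "a \<in> lower_power 2" and b: "b \<in> lower_power 2" and ab: "form a b = 1"
    and a_y: "form (mult a y2) y3 = 1" "form (mult a y2) y4 = 0" "form (mult a y2) y5 = 0"
      "form (mult a y3) y4 = \<alpha>" "form (mult a y3) y5 = 0" "form (mult a y4) y5 = \<beta>"
    and b_y: "form (mult b y2) y3 = 0" "form (mult b y2) y4 = 0" "form (mult b y2) y5 = 1"
      "form (mult b y3) y4 = 1" "form (mult b y3) y5 = 0" "form (mult b y4) y5 = 0"
    and y_y: "form (mult y2 y3) y4 = 0" "form (mult y2 y3) y5 = 0" "form (mult y2 y4) y5 = 0"
      "form (mult y3 y4) y5 = 0"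
  shows "\<exists>x y. saa_P10_44 scale form mult x y \<alpha> \<beta> \<and> x 1 - a \<in> center \<and> y 1 - b \<in> center"
proof -
  \<comment> \<open>Read off from the multiplication table with \<open>a, b\<close> for
    \<open>x 1, y 1\<close>. Having a factor in L^2, these products lie in L^3, hence in the
    center.\<close>
  define x2 x3 x4 x5 where x_defs: "x2 = - mult b y5" "x3 = mult a y2" "x4 = mult b y3" "x5 = mult b y2"
  have cen: "x2 \<in> center" "x3 \<in> center" "x4 \<in> center" "x5 \<in> center"
    unfolding x_defs L3[symmetric]
    using subspace_neg[OF subspace_center[folded L3]] a b mult_in_lower_power_3 by auto
  have center_L2: "center \<subseteq> lower_power 2"
    unfolding L3[symmetric] lower_power_3_eq lower_power_2_eq set_product_def
    by (rule span_mono) blast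
  have abz: "mult a b = 0"
    by (rule mult_lower_power_2_zero[OF L3 a b])
  note T = a_y b_y y_y
  note T' = T T[THEN triple_perms(1)] T[THEN triple_perms(2)] T[THEN triple_perms(3)]
    T[THEN triple_perms(4)] T[THEN triple_perms(5)] abz mult_swap[OF abz]
    cen[THEN form_mult_center(1)]
    cen[THEN mult_zero_if_center] cen[THEN mult_center_right]
    mult_alternating mult_bilinear
  have ab_triple: "form (mult a w) b = 0" "form (mult w a) b = 0"
    "form (mult b w) a = 0" "form (mult w b) a = 0" for w
    using abz mult_swap[OF abz] form_mult_cyclic[of a w b] form_mult_cyclic[of w a b]
      form_mult_cyclic[of b w a] form_mult_cyclic[of w b a] form_mult_cyclic[of b a w]
    by simp_all
  have xy: "form x2 y2 = 1" "form x2 y3 = 0" "form x2 y4 = 0" "form x2 y5 = 0"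
      "form x3 y2 = 0" "form x3 y3 = 1" "form x3 y4 = 0" "form x3 y5 = 0"
      "form x4 y2 = 0" "form x4 y3 = 0" "form x4 y4 = 1" "form x4 y5 = 0"
      "form x5 y2 = 0" "form x5 y3 = 0" "form x5 y4 = 0" "form x5 y5 = 1"
    unfolding x_defs by (simp_all add: T' form_bilinear)
  have swap: "form v u = - c" if "form u v = c" for u v c
    using that form_antisym by metis
  note forms = ab swap[OF ab] xy xy[THEN swap]
    form_center_perp[OF cen(1) a] form_center_perp[OF cen(1) b]
    form_center_perp[OF cen(2) a] form_center_perp[OF cen(2) b]
    form_center_perp[OF cen(3) a] form_center_perp[OF cen(3) b]
    form_center_perp[OF cen(4) a] form_center_perp[OF cen(4) b]
    form_antisym[of y2 a] form_antisym[of y3 a] form_antisym[of y4 a] form_antisym[of y5 a]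
    form_antisym[of y2 b] form_antisym[of y3 b] form_antisym[of y4 b] form_antisym[of y5 b]
    form_antisym[of y3 y2] form_antisym[of y4 y2] form_antisym[of y5 y2]
    form_antisym[of y4 y3] form_antisym[of y5 y3] form_antisym[of y5 y4]
    form_alternating form_bilinear
  have xx: "form z w = 0" if "z \<in> center" "w \<in> center" for z w
    using form_center_perp that center_L2 by blast
  note xx' = xx[OF cen(1) cen(1)] xx[OF cen(1) cen(2)] xx[OF cen(1) cen(3)] xx[OF cen(1) cen(4)]
    xx[OF cen(2) cen(1)] xx[OF cen(2) cen(2)] xx[OF cen(2) cen(3)] xx[OF cen(2) cen(4)]
    xx[OF cen(3) cen(1)] xx[OF cen(3) cen(2)] xx[OF cen(3) cen(3)] xx[OF cen(3) cen(4)]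
    xx[OF cen(4) cen(1)] xx[OF cen(4) cen(2)] xx[OF cen(4) cen(3)] xx[OF cen(4) cen(4)]
  \<comment> \<open>\<open>x2\<close>, ..., \<open>x5\<close> are dual to \<open>y2\<close>, ...,
    \<open>y5\<close>, so \<open>u - ?corr u\<close> is orthogonal to the latter.\<close>
  let ?corr = "\<lambda>u. scale (form u y2) x2 + scale (form u y3) x3 + scale (form u y4) x4 + scale (form u y5) x5"
  define x where "x = (\<lambda>i::nat. if i = 1 then a - ?corr a else if i = 2 then x2 else if i = 3 then x3
    else if i = 4 then x4 else x5)"
  \<comment> \<open>Gram-Schmidt: a multiple of \<open>xi\<close> added to \<open>yj\<close>, for
    \<open>i < j\<close>, cancels \<open>(yi, yj)\<close>.\<close>
  define y where "y = (\<lambda>i::nat. if i = 1 then b - ?corr b else if i = 2 then y2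
    else if i = 3 then y3 + scale (form y2 y3) x2
    else if i = 4 then y4 + scale (form y2 y4) x2 + scale (form y3 y4) x3
    else y5 + scale (form y2 y5) x2 + scale (form y3 y5) x3 + scale (form y4 y5) x4)"
  have x: "x 1 = a - ?corr a" "x 2 = x2" "x 3 = x3" "x 4 = x4" "x 5 = x5"
    and y: "y 1 = b - ?corr b" "y 2 = y2" "y 3 = y3 + scale (form y2 y3) x2"
      "y 4 = y4 + scale (form y2 y4) x2 + scale (form y3 y4) x3"
      "y 5 = y5 + scale (form y2 y5) x2 + scale (form y3 y5) x3 + scale (form y4 y5) x4"
    by (simp_all add: x_def y_def)
  have basis: "standard_basis x y"
  proof (rule standard_basis_if_dim[OF _ dim])
    fix i j :: nat assume "i \<in> {1..5}" "j \<in> {1..5}"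
    then show "form (x i) (x j) = 0 \<and> form (y i) (y j) = 0 \<and> form (x i) (y j) = (if i = j then 1 else 0)"
      unfolding atLeastAtMost_1_5
      by (elim insertE emptyE; hypsubst; simp add: x y forms xx')
  qed
  have "saa_P10_44 scale form mult x y \<alpha> \<beta>"
  proof unfold_locales
    show "standard_basis x y" by (fact basis)
    show "x 2 \<in> center" "x 3 \<in> center" "x 4 \<in> center" "x 5 \<in> center"
      by (simp_all add: x cen)
  qed (rule standard_basis_eqI_explicit[OF basis], simp_all add: x y T' ab_triple forms xx')+
  moreover have "x 1 - a \<in> center" "y 1 - b \<in> center"
    by (simp_all add: x y subspace_add[OF subspace_center] subspace_scale[OF subspace_center]
      subspace_neg[OF subspace_center] subspace_diff[OF subspace_center] cen)
  ultimately show ?thesis by blast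
qed

section \<open>Dual vectors in algebras of type C\<close>

context saa_type_C
begin

text \<open>Pairing with \<open>a\<close> and \<open>b\<close> recovers \<open>t\<close> and
  \<open>- s\<close>, whereas the center is orthogonal to L^2.\<close>

lemma combination_notin_center:
  assumes "a \<in> lower_power 2" "b \<in> lower_power 2" "form a b = 1" "s \<noteq> 0 \<or> t \<noteq> 0"
  shows "scale s a + scale t b \<in> lower_power 2 - center"
proof
  show "scale s a + scale t b \<in> lower_power 2"
    using assms(1,2) by (simp add: subspace_lower_power_2 subspace_add subspace_scale)
  have "form a (scale s a + scale t b) = t" "form b (scale s a + scale t b) = - s"
    using assms(3) form_antisym[of b a] by (simp_all add: form_bilinear form_alternating)
  then show "scale s a + scale t b \<notin> center"
    using assms form_center_lower_power_2 by fastforce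
qed

lemma mem_lower_power_2_if_mult_zero:
  assumes "z \<in> lower_power 2 - center" "mult z u = 0"
  shows "u \<in> lower_power 2"
  using type_C assms unfolding type_C_def phi_def by auto

lemma mult_lower_power_2_in_center: "z \<in> lower_power 2 \<Longrightarrow> mult z u \<in> center"
  using mult_in_lower_power_3 lower_power_3 by blast

text \<open>Duality replaces a dimension count. A vector \<open>v\<close> orthogonal to the range
  satisfies \<open>bv = 0\<close>, so type C puts it in L^2, where it is orthogonal to
  \<open>c\<close>.\<close>

lemma range_mult:
  assumes b: "b \<in> lower_power 2 - center" and c: "c \<in> center"
  shows "\<exists>w. mult b w = c"
proof (rule ccontr)
  assume "\<nexists>w. mult b w = c"
  then have notin: "c \<notin> range (mult b)" by auto
  have "subspace (range (mult b))"
    unfolding subspace_def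
    by (auto simp flip: mult_add_right mult_scale_right) (metis mult_zero_right rangeI)
  from exists_perp_not_perp[OF this notin] obtain v
    where v: "\<forall>w. form (mult b w) v = 0" "form c v = 1" by auto
  have "mult b v = 0"
    by (rule eqI_form) (use v(1) triple_swap23 in \<open>metis form_zero(1) neg_equal_0_iff_equal\<close>)
  then have "v \<in> lower_power 2" using mem_lower_power_2_if_mult_zero b by blast
  then show False
    using v(2) form_center_lower_power_2[of v c] c form_antisym[of c v] by simp
qed

lemma center_neq_zero: "center \<noteq> {0}"
  using dim_center dim_span[of "{}"]
  by (metis dim_eq_card_independent card.empty independent_empty zero_neq_numeral span_empty)

text \<open>Otherwise the nonzero center would lie in the radical of the symplectic form.\<close>

lemma lower_power_2_neq_UNIV: "lower_power 2 \<noteq> UNIV"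
proof
  assume "lower_power 2 = UNIV"
  then have "z = 0" if "z \<in> center" for z
    using that form_center_lower_power_2 form_antisym[of z] by (intro form_nondegenerate) auto
  then show False
    using center_neq_zero subspace_0[OF subspace_center] by auto
qed

text \<open>Since L^3 is nonzero, L^2 has a noncentral element \<open>a\<close>. Only central
  elements are orthogonal to L^2, so \<open>a\<close> pairs nontrivially with some element of
  L^2.\<close>

lemma exists_dual_pair:
  "\<exists>a\<in>lower_power 2. \<exists>b\<in>lower_power 2. form a b = 1"
proof -
  have "lower_power 3 = {0}" if "lower_power 2 \<subseteq> center"
    using that set_product_subset[of "{0}" "lower_power 2" UNIV] subspace_0[OF subspace_set_product]
    unfolding lower_power_3_eq by (force simp: mult_zero_if_center)
  then obtain a where a: "a \<in> lower_power 2" "a \<notin> center"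
    using lower_power_3 center_neq_zero by auto
  then obtain c where c: "c \<in> lower_power 2" "form c a \<noteq> 0"
    using center_if_perp_lower_power_2 by blast
  then have "form a (scale (- 1 / form c a) c) = 1"
    using form_antisym[of a c] by (simp add: form_bilinear)
  then show ?thesis
    using a c subspace_scale[OF subspace_lower_power_2] by blast
qed

text \<open>
  The vector \<open>y2\<close> may be any vector outside \<open>L\<^sup>2\<close>; \<open>y4\<close> is its image under the operator
  \<open>- \<phi>\<^sub>b\<^sup>-\<^sup>1 \<phi>\<^sub>a\<close>, which makes the plane spanned by \<open>y2\<close> and \<open>y4\<close> isotropic for both forms.
\<close>

lemma exists_saa_P10_44:
  assumes a: "a \<in> lower_power 2" and b: "b \<in> lower_power 2" and ab: "form a b = 1"
  shows "\<exists>\<alpha> \<beta> x y. saa_P10_44 scale form mult x y \<alpha> \<beta> \<and> x 1 - a \<in> center \<and> y 1 - b \<in> center"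
proof -
  have ndeg: "u \<in> lower_power 2"
    if "scale s (mult a u) + scale t (mult b u) = 0" "s \<noteq> 0 \<or> t \<noteq> 0" for s t u
    using mem_lower_power_2_if_mult_zero[OF combination_notin_center[OF a b ab that(2)]] that(1)
    by (simp add: mult_bilinear)
  have L2_mult: "mult u w = 0" if "u \<in> lower_power 2" "w \<in> lower_power 2" for u w
    using mult_lower_power_2_zero[OF lower_power_3 that] .
  have b_nc: "b \<in> lower_power 2 - center"
    using combination_notin_center[OF a b ab, of 0 1] by simp
  obtain y2 where y2: "y2 \<notin> lower_power 2"
    using lower_power_2_neq_UNIV by blast
  obtain y4 where y4: "mult b y4 = - mult a y2"
    using range_mult[OF b_nc subspace_neg[OF subspace_center mult_lower_power_2_in_center[OF a]]] by blast
  \<comment> \<open>A dependence would give a nonzero combination of \<open>a\<close> and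
    \<open>b\<close> that annihilates \<open>y2\<close>. Independence yields
    \<open>y5\<close>.\<close>
  have "mult b y2 \<notin> span {mult a y2}"
  proof
    assume "mult b y2 \<in> span {mult a y2}"
    then obtain k where "mult b y2 = scale k (mult a y2)"
      by (auto simp: span_singleton)
    then have "scale (- k) (mult a y2) + scale 1 (mult b y2) = 0" by simp
    then show False using ndeg[of "- k" y2 1] y2 by simp
  qed
  from exists_perp_not_perp[OF subspace_span this] obtain y5
    where "\<forall>s\<in>span {mult a y2}. form s y5 = 0" and b25: "form (mult b y2) y5 = 1" by blast
  then have a25: "form (mult a y2) y5 = 0" by (simp add: span_base)
  \<comment> \<open>Pairing a relation with \<open>y2\<close> and \<open>y5\<close> removes two
    coefficients. What remains puts \<open>y2 - q y5\<close> into L^2, so \<open>b\<close>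
    annihilates it, contrary to \<open>(b y2, y5) = 1\<close>.\<close>
  have "mult a y2 \<notin> span {mult b y2, mult a y5, mult b y5}"
  proof
    assume "mult a y2 \<in> span {mult b y2, mult a y5, mult b y5}"
    then obtain p q r where pqr:
      "mult a y2 = scale p (mult b y2) + (scale q (mult a y5) + scale r (mult b y5))"
      by (auto simp: span_insert span_singleton algebra_simps)
    have "r = 0"
      using arg_cong[OF pqr, of "\<lambda>u. form u y2"] triple_perms(4)[OF a25] triple_perms(4)[OF b25]
      by (simp add: form_bilinear)
    moreover have "p = 0"
      using arg_cong[OF pqr, of "\<lambda>u. form u y5"] a25 b25 by (simp add: form_bilinear)
    ultimately have "mult a (y2 - scale q y5) = 0"
      using pqr by (simp add: mult_bilinear)
    then have "y2 - scale q y5 \<in> lower_power 2"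
      using ndeg[of 1 _ 0] by simp
    then have "mult b (y2 - scale q y5) = 0" using L2_mult b by blast
    then have "form (mult b (y2 - scale q y5)) y5 = 0" by simp
    then show False using b25 by (simp add: mult_bilinear form_bilinear)
  qed
  from exists_perp_not_perp[OF subspace_span this] obtain y3
    where "\<forall>s\<in>span {mult b y2, mult a y5, mult b y5}. form s y3 = 0"
      and a23: "form (mult a y2) y3 = 1" by blast
  then have b23: "form (mult b y2) y3 = 0" and a53: "form (mult a y5) y3 = 0"
    and b53: "form (mult b y5) y3 = 0"
    by (simp_all add: span_base)
  \<comment> \<open>The choice of \<open>y4\<close> turns every value of
    \<open>\<phi>\<^sub>b\<close> at \<open>y4\<close> into one of \<open>\<phi>\<^sub>a\<close> at
    \<open>y2\<close>; only \<open>\<alpha>\<close> and \<open>\<beta>\<close> stay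
    undetermined.\<close>
  have b4: "form (mult b y4) w = - form (mult a y2) w" for w
    by (simp add: y4 form_bilinear)
  have a24: "form (mult a y2) y4 = 0"
    using b4[of y4] by simp
  have b24: "form (mult b y2) y4 = 0"
    using b4[of y2] triple_swap23[of b y2 y4] by simp
  have b34: "form (mult b y3) y4 = 1"
    using b4[of y3] a23 triple_swap23[of b y3 y4] by simp
  have b45: "form (mult b y4) y5 = 0"
    using b4[of y5] a25 by simp
  define \<alpha> \<beta> where "\<alpha> = form (mult a y3) y4" and "\<beta> = form (mult a y4) y5"
  have ab0: "mult a b = 0" using L2_mult a b by blast
  have ab_triple: "form (mult a b) w = 0" "form (mult b a) w = 0" "form (mult a w) b = 0"
    "form (mult w a) b = 0" "form (mult b w) a = 0" "form (mult w b) a = 0" for w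
    using ab0 mult_swap[OF ab0] form_mult_cyclic[of a w b] form_mult_cyclic[of w a b]
      form_mult_cyclic[of b w a] form_mult_cyclic[of w b a] form_mult_cyclic[of b a w]
    by simp_all
  \<comment> \<open>As \<open>ab = 0\<close>, these shifts keep all values of
    \<open>\<phi>\<^sub>a\<close> and \<open>\<phi>\<^sub>b\<close>. The values
    \<open>(a y2, y3) = (b y2, y5) = (b y3, y4) = 1\<close> determine the multiples that kill the
    four triples of the \<open>y\<close>'s.\<close>
  define y3' y4' y5' where y_defs:
    "y3' = y3 + scale (form (mult y2 y3) y5) b"
    "y4' = y4 + scale (form (mult y2 y4) y5) b - scale (form (mult y2 y3) y4) a"
    "y5' = y5 - scale (form (mult y3 y4) y5) b"
  note T = a23 a24 a25 b23 b24 b25 b34 b45 triple_perms(4)[OF a53, simplified]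
    triple_perms(4)[OF b53, simplified] \<alpha>_def[symmetric] \<beta>_def[symmetric]
  note T' = T T[THEN triple_perms(1)] T[THEN triple_perms(2)] T[THEN triple_perms(3)]
    T[THEN triple_perms(4)] T[THEN triple_perms(5)] ab_triple ab0 mult_swap[OF ab0]
    mult_alternating mult_bilinear form_bilinear y_defs
  have "\<exists>x y. saa_P10_44 scale form mult x y \<alpha> \<beta> \<and> x 1 - a \<in> center \<and> y 1 - b \<in> center"
    by (rule saa_P10_44_from_triples[OF dim_10 lower_power_3 a b ab, of y2 y3' y4' y5'])
      (simp_all add: T')
  then show ?thesis by blast
qed

end

section \<open>Change of the symplectic pair\<close>

context saa_P10_44
begin

text \<open>
  Expresses that the operator \<open>A = \<phi>\<^bsub>y 1\<^esub>\<^sup>-\<^sup>1 \<phi>\<^bsub>x 1\<^esub>\<close> on \<open>L/L\<^sup>2\<close> satisfies \<open>A\<^sup>2 = \<alpha> A - \<beta>\<close>;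
  the vector \<open>u\<close> is \<open>A v\<close>.
\<close>

lemma pencil_operator:
  "\<exists>u. mult (y 1) u = mult (x 1) v \<and>
    mult (x 1) u = scale \<alpha> (mult (x 1) v) - scale \<beta> (mult (y 1) v)"
proof -
  let ?b2 = "form (x 2) v" and ?b3 = "form (x 3) v" and ?b4 = "form (x 4) v" and ?b5 = "form (x 5) v"
  \<comment> \<open>Comparing the coefficients of \<open>x 2\<close>, ..., \<open>x 5\<close> in
    \<open>mult_y1\<close> and \<open>mult_x1\<close> solves the first equation.\<close>
  let ?u = "scale (\<beta> * ?b4) (y 2) + scale (\<alpha> * ?b3 - \<beta> * ?b5) (y 3)
    + scale (\<alpha> * ?b4 - ?b2) (y 4) + scale ?b3 (y 5)"
  have "mult (y 1) ?u = mult (x 1) v"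
    by (simp add: mult_bilinear mult_table mult_x1 algebra_simps)
  moreover have "mult (x 1) ?u = scale \<alpha> (mult (x 1) v) - scale \<beta> (mult (y 1) v)"
    by (simp add: mult_bilinear mult_table mult_x1[of v] mult_y1[of v] algebra_simps)
  ultimately show ?thesis by blast
qed

text \<open>The normalization \<open>(x' 1, y' 1) = 1\<close> gives the determinant. Modulo L^2,
  \<open>y' 4\<close> is the negative of the new operator applied to \<open>y' 2\<close>; expressing
  it through \<open>A\<close> and multiplying by \<open>x' 1\<close> determines the new
  parameters.\<close>

lemma parameters_of_other_basis:
  assumes irr: "irreducible [:\<beta>, \<alpha>, 1:]"
    and other: "saa_P10_44 scale form mult x' y' \<alpha>' \<beta>'"
    and x': "x' 1 - (scale a (x 1) + scale b (y 1)) \<in> center"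
    and y': "y' 1 - (scale c (x 1) + scale d (y 1)) \<in> center"
  shows "a * d - b * c = 1"
    and "\<alpha>' = ((a * d + b * c) * \<alpha> + 2 * a * c * \<beta> + 2 * b * d) / (d\<^sup>2 + \<alpha> * c * d + c\<^sup>2 * \<beta>)"
    and "\<beta>' = (b\<^sup>2 + a * b * \<alpha> + a\<^sup>2 * \<beta>) / (d\<^sup>2 + c * d * \<alpha> + c\<^sup>2 * \<beta>)"
proof -
  interpret other: saa_P10_44 scale form mult x' y' \<alpha>' \<beta>' by (rule other)
  obtain z where z: "z \<in> center" "x' 1 = scale a (x 1) + scale b (y 1) + z"
    using x' by (metis diff_add_cancel add.commute)
  obtain z' where z': "z' \<in> center" "y' 1 = scale c (x 1) + scale d (y 1) + z'"
    using y' by (metis diff_add_cancel add.commute)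
  have center_L2: "z \<in> lower_power 2" if "z \<in> center" for z
    using that by (simp add: mem_center_iff mem_lower_power_2_iff)
  have "form (x' 1) (y' 1) = a * d - b * c"
    unfolding z(2) z'(2)
    using form_center_perp[OF z(1)] form_center_perp[OF z'(1)] center_L2[OF z'(1)] basis_in_lower_power_2
    by (simp add: form_bilinear gram algebra_simps)
  then show det: "a * d - b * c = 1"
    using other.gram(3)[of 1 1] by simp
  define N where "N = d\<^sup>2 + \<alpha> * c * d + c\<^sup>2 * \<beta>"
  have cd: "c \<noteq> 0 \<or> d \<noteq> 0" using det by auto
  have N: "N \<noteq> 0" unfolding N_def using pfaffian_nonzero[OF irr cd] by (simp add: algebra_simps)
  define v w where "v = y' 2" and "w = y' 4"
  obtain u where u: "mult (y 1) u = mult (x 1) v"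
      "mult (x 1) u = scale \<alpha> (mult (x 1) v) - scale \<beta> (mult (y 1) v)"
    using pencil_operator by blast
  have v: "v \<notin> lower_power 2"
    using other.mem_lower_power_2_iff other.gram(3)[of 2 2] by (auto simp: v_def)
  have mult_x': "mult (x' 1) t = scale a (mult (x 1) t) + scale b (mult (y 1) t)" for t
    using z by (simp add: mult_bilinear mult_zero_if_center)
  have mult_y': "mult (y' 1) t = scale c (mult (x 1) t) + scale d (mult (y 1) t)" for t
    using z' by (simp add: mult_bilinear mult_zero_if_center)
  have w1: "mult (y' 1) w = - mult (x' 1) v"
    by (simp add: v_def w_def other.mult_table)
  have w2: "mult (x' 1) w = scale \<beta>' (mult (y' 1) v) - scale \<alpha>' (mult (x' 1) v)"
    by (simp add: v_def w_def other.mult_table)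
  \<comment> \<open>The conjugate of \<open>c A + d\<close> is \<open>c (\<alpha> - A) + d\<close>,
    and \<open>N\<close> is the norm. With determinant 1,
    \<open>(c (\<alpha> - A) + d) (a A + b) = A + k\<close>, so the new operator is
    \<open>(A + k) / N\<close> and \<open>w'\<close> below vanishes modulo L^2.\<close>
  define k where "k = a * c * \<beta> + b * d + b * c * \<alpha>"
  define w' where "w' = scale N w + u + scale k v"
  have "mult (y' 1) w' = - scale N (mult (x' 1) v) + mult (y' 1) u + scale k (mult (y' 1) v)"
    by (simp add: w'_def mult_bilinear w1)
  also have "\<dots> = scale (- N * a + c * \<alpha> + d + k * c) (mult (x 1) v)
      + scale (- N * b - c * \<beta> + k * d) (mult (y 1) v)"
    by (simp add: mult_x' mult_y' u algebra_simps)
  also have "- N * a + c * \<alpha> + d + k * c = 0"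
    using det unfolding N_def k_def by algebra
  also have "- N * b - c * \<beta> + k * d = 0"
    using det unfolding N_def k_def by algebra
  finally have "mult (scale c (x 1) + scale d (y 1)) w' = 0"
    using mult_y' by (simp add: mult_bilinear)
  then have w'_L2: "w' \<in> lower_power 2"
    by (rule mem_lower_power_2_if_mult_zero[OF irr cd])
  have "0 = mult (x' 1) w'"
    using mult_lower_power_2[OF other.basis_in_lower_power_2(1) w'_L2] by simp
  also have "\<dots> = scale N (scale \<beta>' (mult (y' 1) v) - scale \<alpha>' (mult (x' 1) v))
      + mult (x' 1) u + scale k (mult (x' 1) v)"
    by (simp add: w'_def mult_bilinear w2)
  also have "\<dots> = scale (N * \<beta>' * c - N * \<alpha>' * a + a * \<alpha> + b + k * a) (mult (x 1) v)
      + scale (N * \<beta>' * d - N * \<alpha>' * b - a * \<beta> + k * b) (mult (y 1) v)"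
    by (simp add: mult_x' mult_y' u algebra_simps)
  finally have "mult (scale (N * \<beta>' * c - N * \<alpha>' * a + a * \<alpha> + b + k * a) (x 1)
      + scale (N * \<beta>' * d - N * \<alpha>' * b - a * \<beta> + k * b) (y 1)) v = 0"
    by (simp add: mult_bilinear)
  \<comment> \<open>A nontrivial combination of \<open>x 1\<close> and \<open>y 1\<close>
    annihilates only elements of L^2, and \<open>v\<close> is not one.\<close>
  then have 1: "N * \<beta>' * c - N * \<alpha>' * a + a * \<alpha> + b + k * a = 0"
    and 2: "N * \<beta>' * d - N * \<alpha>' * b - a * \<beta> + k * b = 0"
    using mem_lower_power_2_if_mult_zero[OF irr] v by blast+
  have "N * \<alpha>' = (a * d + b * c) * \<alpha> + 2 * a * c * \<beta> + 2 * b * d"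
  proof -
    have "N * \<alpha>' * (a * d - b * c) = k * (a * d - b * c) + a * d * \<alpha> + b * d + a * c * \<beta>"
      using 1 2 by algebra
    then show ?thesis by (simp add: det k_def algebra_simps)
  qed
  then show "\<alpha>' = ((a * d + b * c) * \<alpha> + 2 * a * c * \<beta> + 2 * b * d) / (d\<^sup>2 + \<alpha> * c * d + c\<^sup>2 * \<beta>)"
    using N unfolding N_def by (simp add: field_simps)
  have "N * \<beta>' = b\<^sup>2 + a * b * \<alpha> + a\<^sup>2 * \<beta>"
  proof -
    have "N * \<beta>' * (a * d - b * c) = b\<^sup>2 + a * b * \<alpha> + a\<^sup>2 * \<beta>"
      using 1 2 by algebra
    then show ?thesis by (simp add: det)
  qed
  moreover have "d\<^sup>2 + c * d * \<alpha> + c\<^sup>2 * \<beta> = N"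
    by (simp add: N_def algebra_simps)
  ultimately show "\<beta>' = (b\<^sup>2 + a * b * \<alpha> + a\<^sup>2 * \<beta>) / (d\<^sup>2 + c * d * \<alpha> + c\<^sup>2 * \<beta>)"
    using N by (simp add: field_simps)
qed

lemma irreducible_if_type_C:
  assumes "saa_type_C scale form mult"
  shows "irreducible [:\<beta>, \<alpha>, 1:]"
  unfolding irreducible_monic_quadratic_iff
proof (intro allI notI)
  interpret C: saa_type_C scale form mult by (rule assms)
  fix r assume r: "r\<^sup>2 + \<alpha> * r + \<beta> = 0"
  \<comment> \<open>A root \<open>r\<close> makes the form of \<open>x 1 + r y 1\<close> degenerate;
    \<open>?u\<close> represents a nonzero element of its radical.\<close>
  let ?u = "y 4 + scale (\<alpha> + r) (y 2)"
  have \<beta>: "\<beta> = - (r * (\<alpha> + r))"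
    using r by (simp add: power2_eq_square algebra_simps eq_neg_iff_add_eq_0)
  have "mult (scale 1 (x 1) + scale r (y 1)) ?u = 0"
    unfolding mult_bilinear mult_table by (simp add: \<beta> algebra_simps)
  then have "?u \<in> lower_power 2"
    by (rule C.mem_lower_power_2_if_mult_zero[rotated])
      (rule C.combination_notin_center, simp_all add: basis_in_lower_power_2 gram)
  then show False
    by (simp add: mem_lower_power_2_iff form_bilinear gram)
qed

end

section \<open>Isomorphisms\<close>

text \<open>Moves a presentation along an isomorphism, so that two presentations can be compared
  inside one algebra.\<close>

lemma saa_P10_44_transport:
  fixes scale :: "'f::field \<Rightarrow> 'v::ab_group_add \<Rightarrow> 'v" and form mult
    and scale' :: "'f \<Rightarrow> 'w::ab_group_add \<Rightarrow> 'w" and form' mult'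
  assumes iso: "Vector_Spaces.linear scale scale' f" "bij f"
      "\<And>u v. f (mult u v) = mult' (f u) (f v)" "\<And>u v. form' (f u) (f v) = form u v"
    and L: "saa_P10_44 scale form mult x y \<alpha> \<beta>" and L': "saa scale' form' mult'"
  shows "saa_P10_44 scale' form' mult' (\<lambda>i. f (x i)) (\<lambda>i. f (y i)) \<alpha> \<beta>"
proof -
  interpret L: saa_P10_44 scale form mult x y \<alpha> \<beta> by (rule L)
  interpret L': saa scale' form' mult' by (rule L')
  interpret f: Vector_Spaces.linear scale scale' f by (rule iso(1))
  have center: "f z \<in> L'.center" if "z \<in> L.center" for z
    unfolding L'.center_def
  proof (intro CollectI allI)
    fix w
    obtain v where "w = f v" using iso(2) by (metis bij_pointE)
    then show "mult' (f z) w = 0" using that by (simp flip: iso(3) add: L.center_def)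
  qed
  have image: "(\<lambda>i. f (x i)) ` {1..5} \<union> (\<lambda>i. f (y i)) ` {1..5} = f ` (x ` {1..5} \<union> y ` {1..5})"
    by auto
  have "L'.span (f ` (x ` {1..5} \<union> y ` {1..5})) = UNIV"
    using f.span_image[of "x ` {1..5} \<union> y ` {1..5}"] L.basis bij_is_surj[OF iso(2)]
    by (simp add: L.standard_basis_def)
  then have "L'.standard_basis (\<lambda>i. f (x i)) (\<lambda>i. f (y i))"
    by (intro L'.standard_basis_if_span) (auto simp: iso(4) L.gram image)
  then show ?thesis
    by unfold_locales
      (simp_all add: center L.central L.mult_forward f.add f.neg f.diff f.scale f.zero flip: iso(3))
qed

text \<open>The linear map matching the two bases preserves both tables. Injectivity follows from
  preservation of the non-degenerate form.\<close>

lemma saa_isomorphic_if_same_parameters: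
  fixes scale :: "'f::field \<Rightarrow> 'v::ab_group_add \<Rightarrow> 'v" and form mult
    and scale' :: "'f \<Rightarrow> 'w::ab_group_add \<Rightarrow> 'w" and form' mult'
  assumes L: "saa_P10_44 scale form mult x y \<alpha> \<beta>"
    and L': "saa_P10_44 scale' form' mult' x' y' \<alpha> \<beta>"
  shows "saa_isomorphic scale form mult scale' form' mult'"
proof -
  interpret L: saa_P10_44 scale form mult x y \<alpha> \<beta> by (rule L)
  interpret L': saa_P10_44 scale' form' mult' x' y' \<alpha> \<beta> by (rule L')
  define f where "f v =
      scale' (form v (y 1)) (x' 1) + scale' (form v (y 2)) (x' 2) + scale' (form v (y 3)) (x' 3)
      + scale' (form v (y 4)) (x' 4) + scale' (form v (y 5)) (x' 5)
      + scale' (form (x 1) v) (y' 1) + scale' (form (x 2) v) (y' 2) + scale' (form (x 3) v) (y' 3)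
      + scale' (form (x 4) v) (y' 4) + scale' (form (x 5) v) (y' 5)" for v
  have lin: "Vector_Spaces.linear scale scale' f"
    by unfold_locales (simp_all add: f_def L.form_bilinear algebra_simps)
  interpret f: Vector_Spaces.linear scale scale' f by (rule lin)
  have fx: "f (x i) = x' i" and fy: "f (y i) = y' i" if "i \<in> {1..5}" for i
    using that unfolding atLeastAtMost_1_5
    by (elim insertE emptyE; hypsubst; simp add: f_def L.gram)+
  have form: "form' (f u) (f v) = form u v" for u v
  proof -
    have "form u v = form u (y 1) * form (x 1) v + form u (y 2) * form (x 2) v
        + form u (y 3) * form (x 3) v + form u (y 4) * form (x 4) v + form u (y 5) * form (x 5) v
        - form (x 1) u * form v (y 1) - form (x 2) u * form v (y 2) - form (x 3) u * form v (y 3)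
        - form (x 4) u * form v (y 4) - form (x 5) u * form v (y 5)"
      using arg_cong[OF L.expand[of u], of "\<lambda>u. form u v"]
      by (simp add: L.form_bilinear L.form_antisym[of "y _" v])
    then show ?thesis
      by (simp add: f_def L'.form_bilinear L'.gram algebra_simps)
  qed
  have "inj f"
    unfolding f.inj_iff_eq_0
  proof (intro allI impI)
    fix u assume "f u = 0"
    then have "\<forall>v. form u v = 0" using form by (metis L'.form_zero(1))
    then show "u = 0" by (rule L.form_nondegenerate)
  qed
  moreover have "surj f"
  proof (rule surjI)
    fix w
    let ?u = "scale (form' w (y' 1)) (x 1) + scale (form' w (y' 2)) (x 2) + scale (form' w (y' 3)) (x 3)
      + scale (form' w (y' 4)) (x 4) + scale (form' w (y' 5)) (x 5)
      + scale (form' (x' 1) w) (y 1) + scale (form' (x' 2) w) (y 2) + scale (form' (x' 3) w) (y 3)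
      + scale (form' (x' 4) w) (y 4) + scale (form' (x' 5) w) (y 5)"
    show "f ?u = w"
      by (subst (2) L'.expand) (simp add: f.add f.scale fx fy)
  qed
  moreover have "f (mult u v) = mult' (f u) (f v)" for u v
  proof -
    let ?B = "x ` {1..5} \<union> y ` {1..5}"
    have span: "w \<in> L.span ?B" for w
      using L.basis by (simp add: L.standard_basis_def)
    have B: "f (mult b c) = mult' (f b) (f c)" if "b \<in> ?B" "c \<in> ?B" for b c
      using that unfolding atLeastAtMost_1_5 image_insert image_empty Un_insert_left Un_empty_left
      by (elim insertE emptyE; hypsubst;
          simp add: fx fy L.mult_table L'.mult_table f.zero f.neg f.diff f.add f.scale)
    have 1: "f (mult u c) = mult' (f u) (f c)" if "c \<in> ?B" for u c
      using span[of u]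
      by (induction rule: L.span_induct_alt)
        (simp_all add: L.mult_bilinear L'.mult_bilinear f.zero f.add f.scale B that del: Un_iff)
    show ?thesis
      using span[of v]
      by (induction rule: L.span_induct_alt)
        (simp_all add: L.mult_bilinear L'.mult_bilinear f.zero f.add f.scale 1 del: Un_iff)
  qed
  ultimately show ?thesis
    unfolding saa_isomorphic_def bij_def using lin form by blast
qed

section \<open>A model on coordinate vectors\<close>

lemma forall_10: "(\<forall>k::10. P k) \<longleftrightarrow> P 0 \<and> P 1 \<and> P 2 \<and> P 3 \<and> P 4 \<and> P 5 \<and> P 6 \<and> P 7 \<and> P 8 \<and> P 9"
proof -
  have "card {0, 1, 2, 3, 4, 5, 6, 7, 8, 9 :: 10} = CARD(10)" by simp
  then have "UNIV = {0, 1, 2, 3, 4, 5, 6, 7, 8, 9 :: 10}"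
    by (metis card_subset_eq finite_code subset_UNIV)
  then show ?thesis by (metis UNIV_I empty_iff insert_iff)
qed

text \<open>
  The model on \<open>'f ^ 10\<close>: the coordinates \<open>0, \<dots>, 4\<close> belong to \<open>x 1, \<dots>, x 5\<close> and the coordinates
  \<open>5, \<dots>, 9\<close> to \<open>y 1, \<dots>, y 5\<close>.
\<close>

definition model_form :: "'f::field ^ 10 \<Rightarrow> 'f ^ 10 \<Rightarrow> 'f" where
  "model_form u v = u $ 0 * v $ 5 - u $ 5 * v $ 0 + (u $ 1 * v $ 6 - u $ 6 * v $ 1)
    + (u $ 2 * v $ 7 - u $ 7 * v $ 2) + (u $ 3 * v $ 8 - u $ 8 * v $ 3) + (u $ 4 * v $ 9 - u $ 9 * v $ 4)"

text \<open>\<open>D i j\<close> is the coefficient of the product of basis vectors \<open>i\<close>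
  and \<open>j\<close>; each case collects the table entries that involve basis vector
  \<open>k\<close>.\<close>

definition model_mult :: "'f::field \<Rightarrow> 'f \<Rightarrow> 'f ^ 10 \<Rightarrow> 'f ^ 10 \<Rightarrow> 'f ^ 10" where
  "model_mult \<alpha> \<beta> u v = (let D = \<lambda>i j. u $ i * v $ j - u $ j * v $ i in
    (\<chi> k. if k = 0 then D 6 9 + D 7 8
      else if k = 1 then - D 0 7 - D 5 9
      else if k = 2 then D 0 6 - \<alpha> * D 0 8 - D 5 8
      else if k = 3 then \<alpha> * D 0 7 - \<beta> * D 0 9 + D 5 7
      else if k = 4 then \<beta> * D 0 8 + D 5 6
      else if k = 5 then - D 6 7 - \<alpha> * D 7 8 - \<beta> * D 8 9
      else 0))"

lemma model_mult_nth:
  "model_mult \<alpha> \<beta> u v $ 0 = u $ 6 * v $ 9 - u $ 9 * v $ 6 + (u $ 7 * v $ 8 - u $ 8 * v $ 7)"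
  "model_mult \<alpha> \<beta> u v $ 1 = - (u $ 0 * v $ 7 - u $ 7 * v $ 0) - (u $ 5 * v $ 9 - u $ 9 * v $ 5)"
  "model_mult \<alpha> \<beta> u v $ 2 = u $ 0 * v $ 6 - u $ 6 * v $ 0 - \<alpha> * (u $ 0 * v $ 8 - u $ 8 * v $ 0)
    - (u $ 5 * v $ 8 - u $ 8 * v $ 5)"
  "model_mult \<alpha> \<beta> u v $ 3 = \<alpha> * (u $ 0 * v $ 7 - u $ 7 * v $ 0) - \<beta> * (u $ 0 * v $ 9 - u $ 9 * v $ 0)
    + (u $ 5 * v $ 7 - u $ 7 * v $ 5)"
  "model_mult \<alpha> \<beta> u v $ 4 = \<beta> * (u $ 0 * v $ 8 - u $ 8 * v $ 0) + (u $ 5 * v $ 6 - u $ 6 * v $ 5)"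
  "model_mult \<alpha> \<beta> u v $ 5 = - (u $ 6 * v $ 7 - u $ 7 * v $ 6) - \<alpha> * (u $ 7 * v $ 8 - u $ 8 * v $ 7)
    - \<beta> * (u $ 8 * v $ 9 - u $ 9 * v $ 8)"
  "model_mult \<alpha> \<beta> u v $ 6 = 0" "model_mult \<alpha> \<beta> u v $ 7 = 0" "model_mult \<alpha> \<beta> u v $ 8 = 0"
  "model_mult \<alpha> \<beta> u v $ 9 = 0"
  by (simp_all add: model_mult_def)

lemma saa_model: "saa (*s) model_form (model_mult \<alpha> \<beta>)"
proof
  show "\<exists>B. finite B \<and> vec.span B = (UNIV :: ('a ^ 10) set)"
    using vec.finite_Basis vec.span_Basis by blast
next
  fix x :: "'a ^ 10" assume "\<forall>y. model_form x y = 0"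
  then have *: "model_form x (axis k 1) = 0" for k by blast
  show "x = 0"
    unfolding vec_eq_iff forall_10
    using *[of 0] *[of 1] *[of 2] *[of 3] *[of 4] *[of 5] *[of 6] *[of 7] *[of 8] *[of 9]
    by (simp add: model_form_def axis_def)
qed (simp_all add: model_form_def vec_eq_iff forall_10 model_mult_nth algebra_simps)

lemma saa_P10_44_model:
  "\<exists>x y. saa_P10_44 (*s) model_form (model_mult \<alpha> \<beta>) x y \<alpha> (\<beta> :: 'f::field)"
proof -
  interpret saa "(*s)" model_form "model_mult \<alpha> \<beta>" by (rule saa_model)
  define x :: "nat \<Rightarrow> 'f ^ 10" where
    "x i = axis (if i = 1 then 0 else if i = 2 then 1 else if i = 3 then 2 else if i = 4 then 3 else 4) 1" for i
  define y :: "nat \<Rightarrow> 'f ^ 10" where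
    "y i = axis (if i = 1 then 5 else if i = 2 then 6 else if i = 3 then 7 else if i = 4 then 8 else 9) 1" for i
  note defs = x_def y_def model_form_def axis_def
  have basis: "standard_basis x y"
  proof (rule standard_basis_if_dim)
    fix i j :: nat assume "i \<in> {1..5}" "j \<in> {1..5}"
    then show "model_form (x i) (x j) = 0 \<and> model_form (y i) (y j) = 0 \<and> model_form (x i) (y j) = (if i = j then 1 else 0)"
      unfolding atLeastAtMost_1_5
      by (elim insertE emptyE; hypsubst; simp add: defs)
  qed (simp add: card_cart_basis)
  have "saa_P10_44 (*s) model_form (model_mult \<alpha> \<beta>) x y \<alpha> \<beta>"
    by unfold_locales (use basis in \<open>simp_all add: center_def defs vec_eq_iff forall_10 model_mult_nth\<close>)
  then show ?thesis by blast
qed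

text \<open>The algebra on \<open>'f ^ 10\<close> keeps the converse from being vacuous:
  \<open>'v\<close> is arbitrary and may carry no algebra of dimension 10. The isomorphism criterion
  allows two carrier types.\<close>

theorem proposition2p6:
  shows
    "(\<forall>(scale :: 'f::field \<Rightarrow> 'v::ab_group_add \<Rightarrow> 'v) form mult.
        saa_type_C scale form mult \<longrightarrow>
        (\<exists>\<alpha> \<beta>. irreducible [:\<beta>, \<alpha>, 1:] \<and>
           saa.has_presentation scale form mult (P10_44 \<alpha> \<beta>)))
     \<and>
     (\<forall>\<alpha> \<beta> :: 'f. irreducible [:\<beta>, \<alpha>, 1:] \<longrightarrow>
        (\<exists>(form :: 'f ^ 10 \<Rightarrow> 'f ^ 10 \<Rightarrow> 'f) mult.
           saa (*s) form mult \<and> saa.has_presentation (*s) form mult (P10_44 \<alpha> \<beta>)) \<and>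
        (\<forall>(scale :: 'f \<Rightarrow> 'v \<Rightarrow> 'v) form mult.
           saa scale form mult \<and> saa.has_presentation scale form mult (P10_44 \<alpha> \<beta>) \<longrightarrow>
           saa_type_C scale form mult))
     \<and>
     (\<forall>\<alpha> \<beta> \<alpha>' \<beta>' :: 'f. irreducible [:\<beta>, \<alpha>, 1:] \<and> irreducible [:\<beta>', \<alpha>', 1:] \<longrightarrow>
        (\<forall>(scale :: 'f \<Rightarrow> 'v \<Rightarrow> 'v) form mult
          (scale' :: 'f \<Rightarrow> 'w::ab_group_add \<Rightarrow> 'w) form' mult'.
           saa scale form mult \<and> saa.has_presentation scale form mult (P10_44 \<alpha> \<beta>) \<and>
           saa scale' form' mult' \<and> saa.has_presentation scale' form' mult' (P10_44 \<alpha>' \<beta>') \<longrightarrow>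
           (saa_isomorphic scale form mult scale' form' mult' \<longleftrightarrow>
            (\<exists>a b c d. a * d - b * c = 1 \<and>
               \<alpha>' = ((a * d + b * c) * \<alpha> + 2 * a * c * \<beta> + 2 * b * d)
                     / (d\<^sup>2 + \<alpha> * c * d + c\<^sup>2 * \<beta>) \<and>
               \<beta>' = (b\<^sup>2 + a * b * \<alpha> + a\<^sup>2 * \<beta>)
                     / (d\<^sup>2 + c * d * \<alpha> + c\<^sup>2 * \<beta>)))))"
proof (intro conjI allI impI)
  fix scale :: "'f \<Rightarrow> 'v \<Rightarrow> 'v" and form mult
  assume "saa_type_C scale form mult"
  then interpret saa_type_C scale form mult .
  obtain a b where "a \<in> lower_power 2" "b \<in> lower_power 2" "form a b = 1"
    using exists_dual_pair by blast
  then obtain \<alpha> \<beta> x y where "saa_P10_44 scale form mult x y \<alpha> \<beta>"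
    using exists_saa_P10_44 by blast
  then interpret P: saa_P10_44 scale form mult x y \<alpha> \<beta> .
  show "\<exists>\<alpha> \<beta>. irreducible [:\<beta>, \<alpha>, 1:] \<and> has_presentation (P10_44 \<alpha> \<beta>)"
    using P.irreducible_if_type_C P.has_presentation saa_type_C_axioms by blast
next
  fix \<alpha> \<beta> :: 'f assume irr: "irreducible [:\<beta>, \<alpha>, 1:]"
  obtain x y where "saa_P10_44 (*s) model_form (model_mult \<alpha> \<beta>) x y \<alpha> \<beta>"
    using saa_P10_44_model by blast
  then show "\<exists>(form :: 'f ^ 10 \<Rightarrow> 'f ^ 10 \<Rightarrow> 'f) mult.
      saa (*s) form mult \<and> saa.has_presentation (*s) form mult (P10_44 \<alpha> \<beta>)"
    using saa_model saa_P10_44.has_presentation by blast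
next
  fix \<alpha> \<beta> :: 'f and scale :: "'f \<Rightarrow> 'v \<Rightarrow> 'v" and form mult
  assume irr: "irreducible [:\<beta>, \<alpha>, 1:]"
    and L: "saa scale form mult \<and> saa.has_presentation scale form mult (P10_44 \<alpha> \<beta>)"
  then show "saa_type_C scale form mult"
    using saa.saa_P10_44_if_presentation saa_P10_44.saa_type_C by blast
next
  fix \<alpha> \<beta> \<alpha>' \<beta>' :: 'f and scale :: "'f \<Rightarrow> 'v \<Rightarrow> 'v" and form mult
    and scale' :: "'f \<Rightarrow> 'w \<Rightarrow> 'w" and form' mult'
  assume irr: "irreducible [:\<beta>, \<alpha>, 1:] \<and> irreducible [:\<beta>', \<alpha>', 1:]"
    and L: "saa scale form mult \<and> saa.has_presentation scale form mult (P10_44 \<alpha> \<beta>) \<and>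
      saa scale' form' mult' \<and> saa.has_presentation scale' form' mult' (P10_44 \<alpha>' \<beta>')"
  obtain x y where xy: "saa_P10_44 scale form mult x y \<alpha> \<beta>"
    using L saa.saa_P10_44_if_presentation by blast
  obtain x' y' where xy': "saa_P10_44 scale' form' mult' x' y' \<alpha>' \<beta>'"
    using L saa.saa_P10_44_if_presentation by blast
  interpret P: saa_P10_44 scale form mult x y \<alpha> \<beta> by (rule xy)
  interpret P': saa_P10_44 scale' form' mult' x' y' \<alpha>' \<beta>' by (rule xy')
  interpret C: saa_type_C scale form mult using P.saa_type_C irr by blast
  show "saa_isomorphic scale form mult scale' form' mult' \<longleftrightarrow>
      (\<exists>a b c d. a * d - b * c = 1 \<and>
        \<alpha>' = ((a * d + b * c) * \<alpha> + 2 * a * c * \<beta> + 2 * b * d)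
              / (d\<^sup>2 + \<alpha> * c * d + c\<^sup>2 * \<beta>) \<and>
        \<beta>' = (b\<^sup>2 + a * b * \<alpha> + a\<^sup>2 * \<beta>)
              / (d\<^sup>2 + c * d * \<alpha> + c\<^sup>2 * \<beta>))" (is "_ \<longleftrightarrow> ?related")
  proof
    assume "saa_isomorphic scale form mult scale' form' mult'"
    then obtain f where f: "Vector_Spaces.linear scale scale' f" "bij f"
      "\<And>u v. f (mult u v) = mult' (f u) (f v)" "\<And>u v. form' (f u) (f v) = form u v"
      unfolding saa_isomorphic_def by blast
    have "saa_P10_44 scale' form' mult' (\<lambda>i. f (x i)) (\<lambda>i. f (y i)) \<alpha> \<beta>"
      by (rule saa_P10_44_transport[OF f xy P'.saa_axioms])
    then interpret T: saa_P10_44 scale' form' mult' "\<lambda>i. f (x i)" "\<lambda>i. f (y i)" \<alpha> \<beta> .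
    \<comment> \<open>The coordinates of \<open>x' 1\<close> and \<open>y' 1\<close> modulo the
      center, relative to the transported pair.\<close>
    obtain a b c d where
      "x' 1 - (scale' a (f (x 1)) + scale' b (f (y 1))) \<in> P'.center"
      "y' 1 - (scale' c (f (x 1)) + scale' d (f (y 1))) \<in> P'.center"
      using T.lower_power_2_decomp[OF P'.basis_in_lower_power_2(1)]
        T.lower_power_2_decomp[OF P'.basis_in_lower_power_2(6)]
      by (metis add_diff_cancel_left')
    then show ?related
      using T.parameters_of_other_basis[OF _ xy'] irr by blast
  next
    assume ?related
    then obtain a b c d where det: "a * d - b * c = 1"
      and \<alpha>': "\<alpha>' = ((a * d + b * c) * \<alpha> + 2 * a * c * \<beta> + 2 * b * d)
              / (d\<^sup>2 + \<alpha> * c * d + c\<^sup>2 * \<beta>)"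
      and \<beta>': "\<beta>' = (b\<^sup>2 + a * b * \<alpha> + a\<^sup>2 * \<beta>) / (d\<^sup>2 + c * d * \<alpha> + c\<^sup>2 * \<beta>)"
      by blast
    \<comment> \<open>A presentation of the first algebra built on this pair has parameters forced
      to be \<open>\<alpha>'\<close> and \<open>\<beta>'\<close>, so both algebras share a
      multiplication table.\<close>
    let ?a = "scale a (x 1) + scale b (y 1)" and ?b = "scale c (x 1) + scale d (y 1)"
    have "?a \<in> P.lower_power 2" "?b \<in> P.lower_power 2"
      by (simp_all add: P.basis_in_lower_power_2 P.subspace_add[OF P.subspace_lower_power_2]
        P.subspace_scale[OF P.subspace_lower_power_2])
    moreover have "form ?a ?b = 1"
      using det by (simp add: P.form_bilinear P.gram algebra_simps)
    ultimately obtain \<alpha>'' \<beta>'' x'' y'' where Q: "saa_P10_44 scale form mult x'' y'' \<alpha>'' \<beta>''"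
      and "x'' 1 - ?a \<in> P.center" "y'' 1 - ?b \<in> P.center"
      using C.exists_saa_P10_44 by blast
    then have "\<alpha>'' = \<alpha>'" "\<beta>'' = \<beta>'"
      using P.parameters_of_other_basis[OF _ Q] irr \<alpha>' \<beta>' by blast+
    then show "saa_isomorphic scale form mult scale' form' mult'"
      using saa_isomorphic_if_same_parameters Q xy' by blast
  qed
qed

end
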